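(* Let $(M,p)$ be a projective manifold, let $E$ and $F$ be natural vector bundles on $(M,p)$, and let the field $A$ be a natural section of $E\otimes F$. Let $k$ be the rank of $E$. Then the corresponding section $A^{\wedge k}$ of $\Lambda^k(E)\otimes\Lambda^k(F)$ sharply obstructs the existence of nonvanishing local sections $\xi$ of $E^*$ such that $\langle A,\xi\rangle=0$.
   Context: All bundles and sections are smooth. A projective manifold $(M,p)$ is a manifold with a class $p$ of torsion-free affine connections sharing the same unparametrised geodesics; "natural" bundles and sections are those canonically determined by $(M,p)$. The section $A$ of $E\otimes F$ is regarded as a bundle map $A:E^*\to F$, $\xi\mapsto\langle A,\xi\rangle$, and $A^{\wedge k}$ denotes its $k$-th exterior power $\Lambda^k(E^* )\to\Lambda^k(F)$, viewed as a section of $\Lambda^k(E)\otimes\Lambda^k(F)$. A sharp obstruction is an invariant whose vanishing is necessary and sufficient for existence. *)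

theory Defs
  imports "HOL-Analysis.Analysis" "HOL-Library.Function_Algebras"
begin

section \<open>Linear algebra on subspaces\<close>

instantiation "fun" :: (type, real_vector) real_vector
begin

definition scaleR_fun :: "real \<Rightarrow> ('a \<Rightarrow> 'b) \<Rightarrow> 'a \<Rightarrow> 'b"
  where "scaleR_fun r f = (\<lambda>x. r *\<^sub>R f x)"

instance
  by standard
    (simp_all add: scaleR_fun_def plus_fun_def fun_eq_iff scaleR_add_right scaleR_add_left)

end

definition linear_on :: "'v::real_vector set \<Rightarrow> ('v \<Rightarrow> 'w::real_vector) \<Rightarrow> bool"
  where "linear_on V L \<longleftrightarrow>
    (\<forall>u\<in>V. \<forall>v\<in>V. L (u + v) = L u + L v) \<and> (\<forall>r. \<forall>v\<in>V. L (r *\<^sub>R v) = r *\<^sub>R L v)"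

text \<open>Linear maps between subspaces are extended by zero, so that equality of functions is
  equality of linear maps.\<close>

definition Hom :: "'v::real_vector set \<Rightarrow> 'w::real_vector set \<Rightarrow> ('v \<Rightarrow> 'w) set"
  where "Hom V W = {L. linear_on V L \<and> (\<forall>v\<in>V. L v \<in> W) \<and> (\<forall>v. v \<notin> V \<longrightarrow> L v = 0)}"

definition dual :: "'v::real_vector set \<Rightarrow> ('v \<Rightarrow> real) set"
  where "dual V = Hom V UNIV"

definition dual_map :: "'v::real_vector set \<Rightarrow> ('v \<Rightarrow> 'w::real_vector) \<Rightarrow> ('w \<Rightarrow> real) \<Rightarrow> ('v \<Rightarrow> real)"
  where "dual_map V L \<beta> = (\<lambda>v. if v \<in> V then \<beta> (L v) else 0)"

definition is_basis :: "nat \<Rightarrow> (nat \<Rightarrow> 'v::real_vector) \<Rightarrow> 'v set \<Rightarrow> bool"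
  where "is_basis n b V \<longleftrightarrow>
    inj_on b {..<n} \<and> independent (b ` {..<n}) \<and> span (b ` {..<n}) = V"

text \<open>The tensor product of finite-dimensional spaces is \<open>V \<otimes> W = Hom(V\<^sup>*, W)\<close>;
  the decomposable tensor \<open>v \<otimes> w\<close> is the map sending \<open>\<xi>\<close> to \<open>\<langle>\<xi>, v\<rangle> w\<close>.\<close>

definition tensor :: "'v::real_vector set \<Rightarrow> 'w::real_vector set \<Rightarrow> (('v \<Rightarrow> real) \<Rightarrow> 'w) set"
  where "tensor V W = Hom (dual V) W"

definition tensor_prod :: "'v::real_vector set \<Rightarrow> 'v \<Rightarrow> 'w::real_vector \<Rightarrow> ('v \<Rightarrow> real) \<Rightarrow> 'w"
  where "tensor_prod V v w = (\<lambda>\<xi>. if \<xi> \<in> dual V then \<xi> v *\<^sub>R w else 0)"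

text \<open>For finite-dimensional \<open>V\<close>, the exterior power \<open>\<Lambda>\<^sup>k(V)\<close> is the space of alternating
  \<open>k\<close>-linear forms on \<open>V\<^sup>*\<close>: the element \<open>v\<^sub>1 \<and> \<dots> \<and> v\<^sub>k\<close> is the form
  \<open>(\<beta>\<^sub>1, \<dots>, \<beta>\<^sub>k) \<mapsto> det (\<beta>\<^sub>i(v\<^sub>j))\<close>.\<close>

definition ext_power :: "nat \<Rightarrow> 'v::real_vector set \<Rightarrow> ((nat \<Rightarrow> 'v \<Rightarrow> real) \<Rightarrow> real) set"
  where "ext_power k V = {\<omega>.
    (\<forall>\<beta>\<in>{..<k} \<rightarrow>\<^sub>E dual V. \<forall>i<k. linear_on (dual V) (\<lambda>\<alpha>. \<omega> (\<beta>(i := \<alpha>)))) \<and>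
    (\<forall>\<beta>\<in>{..<k} \<rightarrow>\<^sub>E dual V. \<forall>i<k. \<forall>j<k. i \<noteq> j \<and> \<beta> i = \<beta> j \<longrightarrow> \<omega> \<beta> = 0) \<and>
    (\<forall>\<beta>. \<beta> \<notin> {..<k} \<rightarrow>\<^sub>E dual V \<longrightarrow> \<omega> \<beta> = 0)}"

text \<open>\<open>\<Lambda>\<^sup>k(L) : \<Lambda>\<^sup>k(V) \<rightarrow> \<Lambda>\<^sup>k(W)\<close> for linear \<open>L : V \<rightarrow> W\<close>; in this model it is the
  pullback of forms along the transpose \<open>W\<^sup>* \<rightarrow> V\<^sup>*\<close>, and it sends
  \<open>v\<^sub>1 \<and> \<dots> \<and> v\<^sub>k\<close> to \<open>L v\<^sub>1 \<and> \<dots> \<and> L v\<^sub>k\<close>.\<close>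

definition ext_map :: "nat \<Rightarrow> 'v::real_vector set \<Rightarrow> 'w::real_vector set \<Rightarrow> ('v \<Rightarrow> 'w) \<Rightarrow>
    ((nat \<Rightarrow> 'v \<Rightarrow> real) \<Rightarrow> real) \<Rightarrow> ((nat \<Rightarrow> 'w \<Rightarrow> real) \<Rightarrow> real)"
  where "ext_map k V W L = (\<lambda>\<omega> \<beta>.
    if \<omega> \<in> ext_power k V \<and> \<beta> \<in> {..<k} \<rightarrow>\<^sub>E dual W
    then \<omega> (\<lambda>i\<in>{..<k}. dual_map V L (\<beta> i)) else 0)"


section \<open>Smooth manifolds\<close>

text \<open>\<open>C\<^sup>n\<close> and smooth functions on an open set of a finite-dimensional space.\<close>

primrec Ck_on :: "nat \<Rightarrow> 'a::real_normed_vector set \<Rightarrow> ('a \<Rightarrow> 'b::real_normed_vector) \<Rightarrow> bool"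
  where
    "Ck_on 0 S f \<longleftrightarrow> continuous_on S f"
  | "Ck_on (Suc n) S f \<longleftrightarrow>
      (\<forall>x\<in>S. f differentiable (at x)) \<and> (\<forall>v. Ck_on n S (\<lambda>x. frechet_derivative f (at x) v))"

definition smooth_on :: "'a::real_normed_vector set \<Rightarrow> ('a \<Rightarrow> 'b::real_normed_vector) \<Rightarrow> bool"
  where "smooth_on S f \<longleftrightarrow> (\<forall>n. Ck_on n S f)"

text \<open>The dimension of a manifold is \<open>DIM('a)\<close>. A chart is a pair of its domain and its coordinate
  map. A connection is given by its Christoffel symbols in each chart \<open>(U, c)\<close> of the atlas, i.e. by
  a bilinear map on \<open>'a\<close> at each point of \<open>c ` U\<close>.\<close>

type_synonym ('m, 'a) chart = "'m set \<times> ('m \<Rightarrow> 'a)"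
type_synonym ('m, 'a) connection = "('m, 'a) chart \<Rightarrow> 'a \<Rightarrow> 'a \<Rightarrow> 'a \<Rightarrow> 'a"

record ('m, 'a) pmanifold =
  mtop :: "'m topology"
  charts :: "('m, 'a) chart set"
  pclass :: "('m, 'a) connection set"

abbreviation points :: "('m, 'a) pmanifold \<Rightarrow> 'm set"
  where "points M \<equiv> topspace (mtop M)"

definition smooth_manifold :: "('m, 'a::euclidean_space) pmanifold \<Rightarrow> bool"
  where "smooth_manifold M \<longleftrightarrow>
    Hausdorff_space (mtop M) \<and> second_countable (mtop M) \<and>
    points M = (\<Union>(U, c)\<in>charts M. U) \<and>
    (\<forall>(U, c)\<in>charts M. openin (mtop M) U \<and> open (c ` U) \<and>
      homeomorphic_map (subtopology (mtop M) U) (top_of_set (c ` U)) c) \<and>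
    (\<forall>(U, c)\<in>charts M. \<forall>(V, d)\<in>charts M. smooth_on (c ` (U \<inter> V)) (d \<circ> inv_into U c))"

definition smooth_fun :: "('m, 'a::euclidean_space) pmanifold \<Rightarrow> 'm set \<Rightarrow> ('m \<Rightarrow> real) \<Rightarrow> bool"
  where "smooth_fun M U h \<longleftrightarrow>
    openin (mtop M) U \<and> (\<forall>(V, c)\<in>charts M. smooth_on (c ` (U \<inter> V)) (h \<circ> inv_into V c))"

definition smooth_map ::
    "('m, 'a::euclidean_space) pmanifold \<Rightarrow> ('m, 'a) pmanifold \<Rightarrow> 'm set \<Rightarrow> ('m \<Rightarrow> 'm) \<Rightarrow> bool"
  where "smooth_map M N U \<phi> \<longleftrightarrow>
    openin (mtop M) U \<and> continuous_map (subtopology (mtop M) U) (mtop N) \<phi> \<and>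
    (\<forall>(V, c)\<in>charts M. \<forall>(W, d)\<in>charts N.
      smooth_on (c ` (U \<inter> V \<inter> \<phi> -` W)) (d \<circ> \<phi> \<circ> inv_into V c))"


section \<open>Projective manifolds\<close>

text \<open>With \<open>\<tau> = d \<circ> c\<^sup>-\<^sup>1\<close> the change of coordinates, the last conjunct is the transformation law
  \<open>D\<tau>(\<Gamma>\<^sub>c(u,v)) = D\<^sup>2\<tau>(u,v) + \<Gamma>\<^sub>d(D\<tau> u, D\<tau> v)\<close>.\<close>

definition affine_connection ::
    "('m, 'a::euclidean_space) pmanifold \<Rightarrow> ('m, 'a) connection \<Rightarrow> bool"
  where "affine_connection M \<Gamma> \<longleftrightarrow>
    (\<forall>(U, c)\<in>charts M.
      (\<forall>x\<in>c ` U. bilinear (\<Gamma> (U, c) x)) \<and> (\<forall>u v. smooth_on (c ` U) (\<lambda>x. \<Gamma> (U, c) x u v))) \<and>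
    (\<forall>(U, c)\<in>charts M. \<forall>(V, d)\<in>charts M. \<forall>x\<in>c ` (U \<inter> V). \<forall>u v.
      let \<tau> = d \<circ> inv_into U c; D = (\<lambda>y. frechet_derivative \<tau> (at y)) in
      D x (\<Gamma> (U, c) x u v) =
        frechet_derivative (\<lambda>y. D y v) (at x) u + \<Gamma> (V, d) (\<tau> x) (D x u) (D x v))"

definition torsion_free :: "('m, 'a::euclidean_space) pmanifold \<Rightarrow> ('m, 'a) connection \<Rightarrow> bool"
  where "torsion_free M \<Gamma> \<longleftrightarrow>
    (\<forall>(U, c)\<in>charts M. \<forall>x\<in>c ` U. \<forall>u v. \<Gamma> (U, c) x u v = \<Gamma> (U, c) x v u)"

definition geodesic :: "('m, 'a::euclidean_space) pmanifold \<Rightarrow> ('m, 'a) connection \<Rightarrow>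
    real set \<Rightarrow> (real \<Rightarrow> 'm) \<Rightarrow> bool"
  where "geodesic M \<Gamma> I \<gamma> \<longleftrightarrow>
    open I \<and> is_interval I \<and> I \<noteq> {} \<and> continuous_map (top_of_set I) (mtop M) \<gamma> \<and>
    (\<forall>(U, c)\<in>charts M.
      smooth_on {t\<in>I. \<gamma> t \<in> U} (c \<circ> \<gamma>) \<and>
      (\<forall>t\<in>I. \<gamma> t \<in> U \<longrightarrow>
        (let \<gamma>' = (\<lambda>s. vector_derivative (c \<circ> \<gamma>) (at s)) in
          vector_derivative \<gamma>' (at t) + \<Gamma> (U, c) (c (\<gamma> t)) (\<gamma>' t) (\<gamma>' t) = 0)))"

definition unparam_geodesics ::
    "('m, 'a::euclidean_space) pmanifold \<Rightarrow> ('m, 'a) connection \<Rightarrow> 'm set set"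
  where "unparam_geodesics M \<Gamma> = {\<gamma> ` I | \<gamma> I. geodesic M \<Gamma> I \<gamma>}"

definition projective_manifold :: "('m, 'a::euclidean_space) pmanifold \<Rightarrow> bool"
  where "projective_manifold M \<longleftrightarrow> smooth_manifold M \<and>
    (\<exists>\<Gamma>0. affine_connection M \<Gamma>0 \<and> torsion_free M \<Gamma>0 \<and>
      pclass M = {\<Gamma>. affine_connection M \<Gamma> \<and> torsion_free M \<Gamma> \<and>
                     unparam_geodesics M \<Gamma> = unparam_geodesics M \<Gamma>0})"

definition projective_geodesics :: "('m, 'a::euclidean_space) pmanifold \<Rightarrow> 'm set set"
  where "projective_geodesics M = (\<Union>\<Gamma>\<in>pclass M. unparam_geodesics M \<Gamma>)"

text \<open>Projective diffeomorphisms of \<open>M\<close> onto an open subset of \<open>N\<close>.\<close>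

definition projective_embedding ::
    "('m, 'a::euclidean_space) pmanifold \<Rightarrow> ('m, 'a) pmanifold \<Rightarrow> ('m \<Rightarrow> 'm) \<Rightarrow> bool"
  where "projective_embedding M N \<phi> \<longleftrightarrow>
    inj_on \<phi> (points M) \<and> smooth_map M N (points M) \<phi> \<and>
    smooth_map N M (\<phi> ` points M) (inv_into (points M) \<phi>) \<and>
    (\<forall>C\<subseteq>points M. C \<in> projective_geodesics M \<longleftrightarrow> \<phi> ` C \<in> projective_geodesics N)"


section \<open>Vector bundles\<close>

text \<open>A vector bundle is a family of subspaces of an ambient vector space (which carries no
  further meaning), whose smooth structure is given by a covering family of local frames that are
  related by smooth transition matrices. Pairs \<open>(U, e)\<close> of an open set and a frame over it
  correspond to local trivialisations over \<open>U\<close>.\<close>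

record ('m, 'e) vbundle =
  fibre :: "'m \<Rightarrow> 'e set"
  vrank :: nat
  frames :: "('m set \<times> (nat \<Rightarrow> 'm \<Rightarrow> 'e)) set"

definition vector_bundle ::
    "('m, 'a::euclidean_space) pmanifold \<Rightarrow> ('m, 'e::real_vector) vbundle \<Rightarrow> bool"
  where "vector_bundle M B \<longleftrightarrow>
    points M = (\<Union>(U, e)\<in>frames B. U) \<and>
    (\<forall>(U, e)\<in>frames B. openin (mtop M) U \<and>
      (\<forall>x\<in>U. is_basis (vrank B) (\<lambda>i. e i x) (fibre B x))) \<and>
    (\<forall>(U, e)\<in>frames B. \<forall>(V, f)\<in>frames B. \<exists>g.
      (\<forall>i<vrank B. \<forall>j<vrank B. smooth_fun M (U \<inter> V) (g i j)) \<and>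
      (\<forall>x\<in>U \<inter> V. \<forall>j<vrank B. f j x = (\<Sum>i<vrank B. g i j x *\<^sub>R e i x)))"

definition smooth_section :: "('m, 'a::euclidean_space) pmanifold \<Rightarrow>
    ('m, 'e::real_vector) vbundle \<Rightarrow> 'm set \<Rightarrow> ('m \<Rightarrow> 'e) \<Rightarrow> bool"
  where "smooth_section M B U s \<longleftrightarrow>
    openin (mtop M) U \<and> (\<forall>x\<in>U. s x \<in> fibre B x) \<and>
    (\<forall>(V, e)\<in>frames B. \<exists>a.
      (\<forall>i<vrank B. smooth_fun M (U \<inter> V) (a i)) \<and>
      (\<forall>x\<in>U \<inter> V. s x = (\<Sum>i<vrank B. a i x *\<^sub>R e i x)))"

definition dual_bundle :: "('m, 'e::real_vector) vbundle \<Rightarrow> ('m, 'e \<Rightarrow> real) vbundle"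
  where "dual_bundle B = \<lparr>
    fibre = (\<lambda>x. dual (fibre B x)),
    vrank = vrank B,
    frames = {(U, \<theta>). \<exists>e. (U, e) \<in> frames B \<and>
      (\<forall>x\<in>U. \<forall>i<vrank B. \<theta> i x \<in> dual (fibre B x) \<and>
        (\<forall>j<vrank B. \<theta> i x (e j x) = (if i = j then 1 else 0)))}\<rparr>"

text \<open>The frame \<open>e\<^sub>i \<otimes> f\<^sub>j\<close> is enumerated by \<open>n = i * vrank F + j\<close>.\<close>

definition tensor_bundle :: "('m, 'e::real_vector) vbundle \<Rightarrow> ('m, 'f::real_vector) vbundle \<Rightarrow>
    ('m, ('e \<Rightarrow> real) \<Rightarrow> 'f) vbundle"
  where "tensor_bundle E F = \<lparr>
    fibre = (\<lambda>x. tensor (fibre E x) (fibre F x)),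
    vrank = vrank E * vrank F,
    frames = {(U \<inter> V, \<lambda>n x. tensor_prod (fibre E x) (e (n div vrank F) x) (f (n mod vrank F) x))
      | U e V f. (U, e) \<in> frames E \<and> (V, f) \<in> frames F}\<rparr>"


section \<open>Natural bundles and natural sections\<close>

text \<open>``Canonically determined by the projective manifold'' means functorial with respect to
  projective diffeomorphisms onto open subsets: such a map \<open>\<phi> : M \<rightarrow> N\<close> induces an isomorphism of
  the bundle of \<open>M\<close> with the restriction to \<open>\<phi>(M)\<close> of the bundle of \<open>N\<close>. In particular, the
  construction commutes with restriction to open submanifolds. The manifolds are those whose points
  are taken from the type \<open>'m\<close>.\<close>

record ('m, 'a, 'e) natbundle =
  nb_bundle :: "('m, 'a) pmanifold \<Rightarrow> ('m, 'e) vbundle"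
  nb_map :: "('m, 'a) pmanifold \<Rightarrow> ('m, 'a) pmanifold \<Rightarrow> ('m \<Rightarrow> 'm) \<Rightarrow> 'm \<Rightarrow> 'e \<Rightarrow> 'e"

definition natural_bundle :: "('m, 'a::euclidean_space, 'e::real_vector) natbundle \<Rightarrow> bool"
  where "natural_bundle B \<longleftrightarrow>
    (\<forall>M. projective_manifold M \<longrightarrow>
      vector_bundle M (nb_bundle B M) \<and>
      (\<forall>x\<in>points M. \<forall>v\<in>fibre (nb_bundle B M) x. nb_map B M M id x v = v)) \<and>
    (\<forall>M N \<phi>. projective_manifold M \<and> projective_manifold N \<and> projective_embedding M N \<phi> \<longrightarrow>
      (\<forall>x\<in>points M.
        linear_on (fibre (nb_bundle B M) x) (nb_map B M N \<phi> x) \<and>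
        bij_betw (nb_map B M N \<phi> x) (fibre (nb_bundle B M) x) (fibre (nb_bundle B N) (\<phi> x))) \<and>
      (\<forall>U s. smooth_section M (nb_bundle B M) U s \<longrightarrow>
        smooth_section N (nb_bundle B N) (\<phi> ` U)
          (\<lambda>y. let x = inv_into (points M) \<phi> y in nb_map B M N \<phi> x (s x))) \<and>
      (\<forall>\<psi>. (\<forall>x\<in>points M. \<psi> x = \<phi> x) \<longrightarrow>
        (\<forall>x\<in>points M. \<forall>v\<in>fibre (nb_bundle B M) x. nb_map B M N \<psi> x v = nb_map B M N \<phi> x v))) \<and>
    (\<forall>M N P \<phi> \<psi>. projective_manifold M \<and> projective_manifold N \<and> projective_manifold P \<and>
        projective_embedding M N \<phi> \<and> projective_embedding N P \<psi> \<longrightarrow>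
      (\<forall>x\<in>points M. \<forall>v\<in>fibre (nb_bundle B M) x.
        nb_map B M P (\<psi> \<circ> \<phi>) x v = nb_map B N P \<psi> (\<phi> x) (nb_map B M N \<phi> x v)))"

definition natural_section :: "('m, 'a::euclidean_space, 'e::real_vector) natbundle \<Rightarrow>
    (('m, 'a) pmanifold \<Rightarrow> 'm \<Rightarrow> 'e) \<Rightarrow> bool"
  where "natural_section B s \<longleftrightarrow>
    (\<forall>M. projective_manifold M \<longrightarrow> smooth_section M (nb_bundle B M) (points M) (s M)) \<and>
    (\<forall>M N \<phi>. projective_manifold M \<and> projective_manifold N \<and> projective_embedding M N \<phi> \<longrightarrow>
      (\<forall>x\<in>points M. nb_map B M N \<phi> x (s M x) = s N (\<phi> x)))"

definition nat_tensor :: "('m, 'a::euclidean_space, 'e::real_vector) natbundle \<Rightarrow>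
    ('m, 'a, 'f::real_vector) natbundle \<Rightarrow> ('m, 'a, ('e \<Rightarrow> real) \<Rightarrow> 'f) natbundle"
  where "nat_tensor E F = \<lparr>
    nb_bundle = (\<lambda>M. tensor_bundle (nb_bundle E M) (nb_bundle F M)),
    nb_map = (\<lambda>M N \<phi> x T \<xi>.
      if \<xi> \<in> dual (fibre (nb_bundle E N) (\<phi> x))
      then nb_map F M N \<phi> x (T (dual_map (fibre (nb_bundle E M) x) (nb_map E M N \<phi> x) \<xi>))
      else 0)\<rparr>"


section \<open>Sharp obstructions\<close>

text \<open>\<open>A\<^sup>\<and>\<^sup>k\<close> as a map \<open>\<Lambda>\<^sup>k(E\<^sup>*) \<rightarrow> \<Lambda>\<^sup>k(F)\<close> at each point, i.e. as an element of
  \<open>\<Lambda>\<^sup>k(E) \<otimes> \<Lambda>\<^sup>k(F)\<close> via \<open>\<Lambda>\<^sup>k(E\<^sup>*) = \<Lambda>\<^sup>k(E)\<^sup>*\<close>.\<close>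

definition wedge_power :: "nat \<Rightarrow> ('m, 'e::real_vector) vbundle \<Rightarrow> ('m, 'f::real_vector) vbundle \<Rightarrow>
    ('m \<Rightarrow> ('e \<Rightarrow> real) \<Rightarrow> 'f) \<Rightarrow>
    'm \<Rightarrow> ((nat \<Rightarrow> ('e \<Rightarrow> real) \<Rightarrow> real) \<Rightarrow> real) \<Rightarrow> ((nat \<Rightarrow> 'f \<Rightarrow> real) \<Rightarrow> real)"
  where "wedge_power k E F A x = ext_map k (dual (fibre E x)) (fibre F x) (A x)"

text \<open>The section \<open>I\<close> sharply obstructs the existence of local solutions, where \<open>P V \<xi>\<close> says that
  \<open>\<xi>\<close> is a solution over the open set \<open>V\<close>, if on every open set \<open>U\<close> the vanishing of \<open>I\<close> is
  necessary and sufficient for the existence of solutions locally in \<open>U\<close>: arbitrarily close to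
  every point, but not necessarily around every point. Existence around every point is not
  the intended notion: for instance, \<open>x dx + y dy\<close> on the plane is annihilated by no vector field
  that is nonvanishing near the origin, although it is annihilated by one around every other point.\<close>

definition sharply_obstructs :: "('m, 'a::euclidean_space) pmanifold \<Rightarrow> ('m \<Rightarrow> 'z::zero) \<Rightarrow>
    ('m set \<Rightarrow> ('m \<Rightarrow> 's) \<Rightarrow> bool) \<Rightarrow> bool"
  where "sharply_obstructs M I P \<longleftrightarrow>
    (\<forall>U. openin (mtop M) U \<longrightarrow>
      ((\<forall>x\<in>U. I x = 0) \<longleftrightarrow>
       (\<forall>W. openin (mtop M) W \<and> W \<noteq> {} \<and> W \<subseteq> U \<longrightarrow>
         (\<exists>V \<xi>. openin (mtop M) V \<and> V \<noteq> {} \<and> V \<subseteq> W \<and> P V \<xi>))))"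

end

theory Submission
  imports Defs
begin

text \<open>Since \<open>k\<close> is the rank of \<open>E\<^sup>*\<close>, the map \<open>A\<^sup>\<and>\<^sup>k\<close> vanishes at a point exactly when \<open>A\<close> has a
  nontrivial kernel there. In local frames this says that the rows of a smooth matrix are linearly
  dependent. Independence is an open condition, so solutions on a dense set of points force
  \<open>A\<^sup>\<and>\<^sup>k\<close> to vanish everywhere. Conversely, if the rows are dependent at every point, Gaussian
  elimination with pivots that do not vanish on a smaller and smaller open set produces a smooth
  nonvanishing section of the kernel.\<close>

section \<open>Bases and dual bases\<close>

text \<open>The obstacle is that the rank of \<open>A\<close> need not be locally constant. Its
  kernel is then not a subbundle, and a kernel vector at one point need not extend to a smooth
  solution around it. The way out is a dichotomy for each column of the local matrix: either the
  column vanishes on the whole current open set, or one of its entries is nonzero on a nonempty open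
  subset, to which everything is then restricted. Both cases leave a matrix with one column fewer,
  so the restriction happens only finitely often.

  The link between \<open>A\<close> and its exterior power is a dimension count. If \<open>A\<close>
  kills some nonzero covector, the functionals pulled back along \<open>A\<close> all annihilate it.
  They lie in a proper subspace of a \<open>k\<close>-dimensional space, so any \<open>k\<close> of
  them are dependent and every alternating form vanishes on them. If \<open>A\<close> is injective,
  the determinant form of a basis takes the value 1 on suitable pulled-back functionals, so the
  exterior power is not zero.

  The same elimination also shows that independence of rows is an open condition, so no minors are
  needed.\<close>

lemma sum_kronecker:
  fixes c :: "nat \<Rightarrow> 'v::real_vector"
  assumes "i < n"
  shows "(\<Sum>j<n. (if i = j then 1 else 0) *\<^sub>R c j) = c i"
    and "(\<Sum>j<n. (if j = i then 1 else 0) *\<^sub>R c j) = c i"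
proof -
  have *: "(if P then 1 else 0) *\<^sub>R v = (if P then v else 0)" for P and v :: 'v
    by simp
  show "(\<Sum>j<n. (if i = j then 1 else 0) *\<^sub>R c j) = c i"
    and "(\<Sum>j<n. (if j = i then 1 else 0) *\<^sub>R c j) = c i"
    using assms by (simp_all only: * sum.delta sum.delta' finite_lessThan lessThan_iff if_True)
qed

lemma linear_on_sum:
  assumes V: "subspace V" and L: "linear_on V L" and v: "\<And>i. i \<in> I \<Longrightarrow> v i \<in> V"
  shows "L (\<Sum>i\<in>I. c i *\<^sub>R v i) = (\<Sum>i\<in>I. c i *\<^sub>R L (v i))"
proof -
  have L0: "L 0 = 0"
    using L subspace_0[OF V] unfolding linear_on_def by (metis scaleR_zero_left)
  show ?thesis
    using v
  proof (induction I rule: infinite_finite_induct)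
    case (insert i I)
    have "(\<Sum>i\<in>I. c i *\<^sub>R v i) \<in> V" "c i *\<^sub>R v i \<in> V"
      using V insert.prems by (auto intro!: subspace_sum subspace_scale)
    then show ?case
      using insert L unfolding linear_on_def by simp
  qed (simp_all add: L0)
qed

lemma subspace_Hom:
  assumes "subspace W"
  shows "subspace (Hom V W)"
  using assms
  by (auto simp: subspace_def Hom_def linear_on_def plus_fun_def scaleR_fun_def zero_fun_def
      algebra_simps)

lemma subspace_dual: "subspace (dual V)"
  unfolding dual_def by (rule subspace_Hom) (rule subspace_UNIV)

lemma sum_scaleR_fun_apply:
  fixes g :: "'i \<Rightarrow> 'v \<Rightarrow> 'w::real_vector"
  shows "(\<Sum>i\<in>I. c i *\<^sub>R g i) x = (\<Sum>i\<in>I. c i *\<^sub>R g i x)"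
  by (induction I rule: infinite_finite_induct) (auto simp: scaleR_fun_def)

lemma dual_sum:
  assumes "subspace V" "\<beta> \<in> dual V" "\<And>i. i \<in> I \<Longrightarrow> v i \<in> V"
  shows "\<beta> (\<Sum>i\<in>I. c i *\<^sub>R v i) = (\<Sum>i\<in>I. c i * \<beta> (v i))"
  using linear_on_sum[OF assms(1), of \<beta> I v c] assms(2,3) by (auto simp: dual_def Hom_def)

text \<open>The family need not span \<open>V\<close>: the lemma is later applied to the images of a
  basis under an injective map into a space of unknown dimension. Each functional comes from a
  linear extension to the whole type, cut off to 0 outside \<open>V\<close> as \<open>dual\<close>
  demands.\<close>

lemma independent_dual_family:
  assumes V: "subspace V" and b: "inj_on b {..<n}" "independent (b ` {..<n})" "b ` {..<n} \<subseteq> V"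
  shows "\<exists>\<theta>. (\<forall>i<n. \<theta> i \<in> dual V) \<and>
    (\<forall>i<n. \<forall>j<n. \<theta> i (b j) = (if i = j then 1 else (0::real)))"
proof -
  have "\<exists>\<beta>. \<beta> \<in> dual V \<and> (\<forall>j<n. \<beta> (b j) = (if i = j then 1 else 0))" if "i < n" for i
  proof -
    obtain g :: "'a \<Rightarrow> real" where g: "linear g" "\<And>v. v \<in> b ` {..<n} \<Longrightarrow> g v = (if v = b i then 1 else 0)"
      using linear_independent_extend[OF b(2), of "\<lambda>v. if v = b i then 1 else 0"] by blast
    define \<beta> where "\<beta> = (\<lambda>v. if v \<in> V then g v else 0)"
    have "\<beta> \<in> dual V"
      using V g(1) unfolding \<beta>_def dual_def Hom_def linear_on_def
      by (auto simp: subspace_add subspace_scale linear_add linear_cmul)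
    moreover have "\<beta> (b j) = (if i = j then 1 else 0)" if "j < n" for j
    proof -
      have "b j \<in> V" "b j \<in> b ` {..<n}"
        using b(3) that by auto
      moreover have "b j = b i \<longleftrightarrow> i = j"
        using b(1) that \<open>i < n\<close> by (auto dest: inj_onD)
      ultimately show ?thesis
        unfolding \<beta>_def by (auto simp: g(2))
    qed
    ultimately show ?thesis by blast
  qed
  then show ?thesis by metis
qed

lemma is_basisD:
  assumes "is_basis n b V"
  shows "subspace V" "\<And>i. i < n \<Longrightarrow> b i \<in> V"
  using assms by (auto simp: is_basis_def intro: span_base)

lemma is_basis_expand:
  assumes b: "is_basis n b V" and v: "v \<in> V"
  obtains c where "v = (\<Sum>i<n. c i *\<^sub>R b i)"
proof -
  have "v \<in> span (b ` {..<n})" and inj: "inj_on b {..<n}"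
    using b v by (auto simp: is_basis_def)
  then obtain u where "v = (\<Sum>w\<in>b ` {..<n}. u w *\<^sub>R w)"
    by (auto simp: span_finite)
  also have "\<dots> = (\<Sum>i<n. u (b i) *\<^sub>R b i)"
    using inj by (simp add: sum.reindex)
  finally show thesis by (rule that)
qed

lemma is_basis_unique:
  assumes b: "is_basis n b V" and zero: "(\<Sum>i<n. c i *\<^sub>R b i) = 0" and i: "i < n"
  shows "c i = 0"
proof -
  have V: "subspace V" "\<And>i. i < n \<Longrightarrow> b i \<in> V"
    by (rule is_basisD[OF b])+
  obtain \<theta> where \<theta>: "\<forall>i<n. \<theta> i \<in> dual V"
      "\<forall>i<n. \<forall>j<n. \<theta> i (b j) = (if i = j then 1 else (0::real))"
    using independent_dual_family[of V b n] V b by (auto simp: is_basis_def)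
  have "\<theta> i (\<Sum>j<n. c j *\<^sub>R b j) = (\<Sum>j<n. c j * \<theta> i (b j))"
    using V \<theta>(1) i by (intro dual_sum) auto
  also have "\<dots> = (\<Sum>j<n. (if i = j then 1 else 0) *\<^sub>R c j)"
    using \<theta>(2) i by (intro sum.cong) auto
  also have "\<dots> = c i"
    using i by (rule sum_kronecker)
  finally have "c i = \<theta> i 0"
    by (simp add: zero)
  also have "\<theta> i 0 = 0"
    using dual_sum[OF V(1), of "\<theta> i" "{}" b] \<theta>(1) i by simp
  finally show ?thesis .
qed

text \<open>The equation is between functions on the whole type. Inside \<open>V\<close> it follows
  by expanding the argument in the basis; outside \<open>V\<close> both sides are 0 because linear
  maps are extended by zero.\<close>

lemma dual_expand:
  assumes b: "is_basis n b V" and \<theta>: "\<And>i. i < n \<Longrightarrow> \<theta> i \<in> dual V"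
      "\<And>i j. i < n \<Longrightarrow> j < n \<Longrightarrow> \<theta> i (b j) = (if i = j then 1 else (0::real))"
    and \<xi>: "\<xi> \<in> dual V"
  shows "\<xi> = (\<Sum>i<n. \<xi> (b i) *\<^sub>R \<theta> i)"
proof
  fix v
  have V: "subspace V" "\<And>i. i < n \<Longrightarrow> b i \<in> V"
    by (rule is_basisD[OF b])+
  show "\<xi> v = (\<Sum>i<n. \<xi> (b i) *\<^sub>R \<theta> i) v"
  proof (cases "v \<in> V")
    case True
    obtain c where v: "v = (\<Sum>i<n. c i *\<^sub>R b i)"
      using is_basis_expand[OF b True] .
    have "\<theta> i v = c i" if "i < n" for i
    proof -
      have "\<theta> i v = (\<Sum>j<n. c j * \<theta> i (b j))"
        unfolding v using V \<theta>(1) that by (intro dual_sum) auto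
      also have "\<dots> = (\<Sum>j<n. (if i = j then 1 else 0) *\<^sub>R c j)"
        using \<theta>(2) that by (intro sum.cong) auto
      finally show ?thesis
        using that by (simp only: sum_kronecker)
    qed
    moreover have "\<xi> v = (\<Sum>i<n. c i * \<xi> (b i))"
      unfolding v using V \<xi> by (intro dual_sum) auto
    ultimately show ?thesis
      by (simp add: sum_scaleR_fun_apply mult.commute)
  next
    case False
    then have "\<xi> v = 0" "\<And>i. i < n \<Longrightarrow> \<theta> i v = 0"
      using \<xi> \<theta>(1) by (auto simp: dual_def Hom_def)
    then show ?thesis
      by (simp add: sum_scaleR_fun_apply)
  qed
qed

lemma dual_coordinates:
  assumes b: "is_basis n b V" and \<theta>: "\<And>i. i < n \<Longrightarrow> \<theta> i \<in> dual V"
      "\<And>i j. i < n \<Longrightarrow> j < n \<Longrightarrow> \<theta> i (b j) = (if i = j then 1 else (0::real))"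
  shows "(\<Sum>i<n. c i *\<^sub>R \<theta> i) \<in> dual V"
    and "j < n \<Longrightarrow> (\<Sum>i<n. c i *\<^sub>R \<theta> i) (b j) = c j"
proof -
  show "(\<Sum>i<n. c i *\<^sub>R \<theta> i) \<in> dual V"
    using subspace_dual \<theta>(1) by (intro subspace_sum subspace_scale) auto
  assume j: "j < n"
  have "(\<Sum>i<n. c i *\<^sub>R \<theta> i) (b j) = (\<Sum>i<n. (if i = j then 1 else 0) *\<^sub>R c i)"
    unfolding sum_scaleR_fun_apply using \<theta>(2) j by (intro sum.cong) auto
  then show "(\<Sum>i<n. c i *\<^sub>R \<theta> i) (b j) = c j"
    using j by (simp only: sum_kronecker)
qed

text \<open>Evaluating a combination of the \<open>\<theta> i\<close> at \<open>b j\<close> isolates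
  the coefficient \<open>j\<close>, which gives independence; \<open>dual_expand\<close> gives
  spanning. The lemma is used at two levels: for the dual of a fibre, and for the dual of that dual,
  on which the alternating forms live.\<close>

lemma dual_basis:
  assumes b: "is_basis n b V"
  obtains \<theta> where "\<And>i. i < n \<Longrightarrow> \<theta> i \<in> dual V"
    "\<And>i j. i < n \<Longrightarrow> j < n \<Longrightarrow> \<theta> i (b j) = (if i = j then 1 else (0::real))"
    "is_basis n \<theta> (dual V)"
proof -
  have V: "subspace V" "\<And>i. i < n \<Longrightarrow> b i \<in> V"
    by (rule is_basisD[OF b])+
  have "inj_on b {..<n}" "independent (b ` {..<n})" "b ` {..<n} \<subseteq> V"
    using b V(2) by (auto simp: is_basis_def)
  from independent_dual_family[OF V(1) this] obtain \<theta>
    where \<theta>: "\<And>i. i < n \<Longrightarrow> \<theta> i \<in> dual V"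
      "\<And>i j. i < n \<Longrightarrow> j < n \<Longrightarrow> \<theta> i (b j) = (if i = j then 1 else (0::real))"
    by metis
  have inj: "inj_on \<theta> {..<n}"
  proof (rule inj_onI)
    fix i j assume "i \<in> {..<n}" "j \<in> {..<n}" "\<theta> i = \<theta> j"
    then show "i = j"
      using \<theta>(2)[of i i] \<theta>(2)[of j i] by (metis lessThan_iff zero_neq_one)
  qed
  have "independent (\<theta> ` {..<n})"
  proof (rule independent_if_scalars_zero)
    fix u \<beta> assume "(\<Sum>\<beta>\<in>\<theta> ` {..<n}. u \<beta> *\<^sub>R \<beta>) = 0" and "\<beta> \<in> \<theta> ` {..<n}"
    then obtain j where j: "j < n" "\<beta> = \<theta> j" and z: "(\<Sum>i<n. u (\<theta> i) *\<^sub>R \<theta> i) = 0"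
      using inj by (auto simp: sum.reindex)
    have "u (\<theta> j) = (\<Sum>i<n. u (\<theta> i) *\<^sub>R \<theta> i) (b j)"
      using dual_coordinates(2)[OF b \<theta> j(1), of "\<lambda>i. u (\<theta> i)"] by simp
    then show "u \<beta> = 0"
      using z j by (simp add: zero_fun_def)
  qed simp
  moreover have "span (\<theta> ` {..<n}) = dual V"
  proof
    show "span (\<theta> ` {..<n}) \<subseteq> dual V"
      using \<theta>(1) by (intro span_minimal subspace_dual) auto
    show "dual V \<subseteq> span (\<theta> ` {..<n})"
    proof
      fix \<xi> assume \<xi>: "\<xi> \<in> dual V"
      have "\<xi> = (\<Sum>i<n. \<xi> (b i) *\<^sub>R \<theta> i)"
        using \<theta> \<xi> by (intro dual_expand[OF b]) simp_all
      also have "\<dots> \<in> span (\<theta> ` {..<n})"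
        by (intro span_sum span_scale span_base) auto
      finally show "\<xi> \<in> span (\<theta> ` {..<n})" .
    qed
  qed
  ultimately have "is_basis n \<theta> (dual V)"
    using inj by (simp add: is_basis_def)
  with \<theta> show thesis by (rule that)
qed


section \<open>Exterior powers of a linear map\<close>

lemma dual_map_in_dual:
  assumes "subspace V" "L \<in> Hom V W" "\<beta> \<in> dual W"
  shows "dual_map V L \<beta> \<in> dual V"
  using assms unfolding dual_map_def dual_def Hom_def linear_on_def
  by (auto simp: subspace_add subspace_scale)

text \<open>One entry is a combination of the others. Expanding by linearity in that slot leaves
  terms in which an entry is repeated, and these vanish. Independence of the image set says nothing
  about repetitions in the tuple, so injectivity is a separate condition and its failure a separate
  case.\<close>

lemma ext_power_dependent:
  assumes \<omega>: "\<omega> \<in> ext_power k V" and \<gamma>: "\<gamma> \<in> {..<k} \<rightarrow>\<^sub>E dual V"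
    and dep: "\<not> (inj_on \<gamma> {..<k} \<and> independent (\<gamma> ` {..<k}))"
  shows "\<omega> \<gamma> = 0"
proof (cases "inj_on \<gamma> {..<k}")
  case False
  then obtain i j where "i < k" "j < k" "i \<noteq> j" "\<gamma> i = \<gamma> j"
    by (auto simp: inj_on_def)
  then show ?thesis
    using \<omega> \<gamma> unfolding ext_power_def by blast
next
  case inj: True
  then obtain i where i: "i < k" and span: "\<gamma> i \<in> span (\<gamma> ` {..<k} - {\<gamma> i})"
    using dep by (auto simp: dependent_def)
  have "\<gamma> ` {..<k} - {\<gamma> i} = \<gamma> ` ({..<k} - {i})"
    using inj i by (auto simp: inj_on_def)
  with span obtain u where "\<gamma> i = (\<Sum>\<beta>\<in>\<gamma> ` ({..<k} - {i}). u \<beta> *\<^sub>R \<beta>)"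
    by (auto simp: span_finite)
  also have "\<dots> = (\<Sum>j\<in>{..<k} - {i}. u (\<gamma> j) *\<^sub>R \<gamma> j)"
    using inj by (subst sum.reindex) (auto intro: inj_on_subset)
  finally have \<gamma>i: "\<gamma> i = (\<Sum>j\<in>{..<k} - {i}. u (\<gamma> j) *\<^sub>R \<gamma> j)" .
  have lin: "linear_on (dual V) (\<lambda>\<alpha>. \<omega> (\<gamma>(i := \<alpha>)))"
    using \<omega> \<gamma> i unfolding ext_power_def by blast
  have "\<omega> \<gamma> = \<omega> (\<gamma>(i := \<Sum>j\<in>{..<k} - {i}. u (\<gamma> j) *\<^sub>R \<gamma> j))"
    unfolding \<gamma>i[symmetric] by simp
  also have "\<dots> = (\<Sum>j\<in>{..<k} - {i}. u (\<gamma> j) *\<^sub>R \<omega> (\<gamma>(i := \<gamma> j)))"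
    using \<gamma> by (intro linear_on_sum[OF subspace_dual lin]) auto
  also have "\<dots> = 0"
  proof (rule sum.neutral, rule ballI)
    fix j assume "j \<in> {..<k} - {i}"
    then have j: "j < k" "j \<noteq> i" by auto
    have "\<gamma>(i := \<gamma> j) \<in> {..<k} \<rightarrow>\<^sub>E dual V"
      using \<gamma> i j by (auto simp: PiE_def extensional_def Pi_def)
    moreover have "(\<gamma>(i := \<gamma> j)) i = (\<gamma>(i := \<gamma> j)) j"
      using j by simp
    ultimately have "\<omega> (\<gamma>(i := \<gamma> j)) = 0"
      using \<omega> i j unfolding ext_power_def by blast
    then show "u (\<gamma> j) *\<^sub>R \<omega> (\<gamma>(i := \<gamma> j)) = 0"
      by simp
  qed
  finally show ?thesis .
qed

text \<open>The element \<open>b 0 \<and> ... \<and> b (k - 1)\<close> of the exterior power, that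
  is, the determinant of the matrix \<open>\<beta> i (b j)\<close>. As \<open>k\<close> is a number
  and not an index type, the determinant is spelled out by the Leibniz formula.\<close>

definition det_form :: "nat \<Rightarrow> 'v::real_vector set \<Rightarrow> (nat \<Rightarrow> 'v) \<Rightarrow> (nat \<Rightarrow> 'v \<Rightarrow> real) \<Rightarrow> real"
  where "det_form k V b \<beta> = (if \<beta> \<in> {..<k} \<rightarrow>\<^sub>E dual V
    then \<Sum>p | p permutes {..<k}. of_int (sign p) * (\<Prod>i<k. \<beta> i (b (p i))) else 0)"

text \<open>Slot \<open>i\<close> contributes exactly one factor to each Leibniz term, hence
  linearity. If the entries \<open>i\<close> and \<open>j\<close> agree, composing every permutation
  with their transposition flips each sign and keeps each product, so the sum equals its own
  negative.\<close>

lemma det_form_in_ext_power: "det_form k V b \<in> ext_power k V"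
proof -
  have "linear_on (dual V) (\<lambda>\<alpha>. det_form k V b (\<beta>(i := \<alpha>)))"
    if \<beta>: "\<beta> \<in> {..<k} \<rightarrow>\<^sub>E dual V" and i: "i < k" for \<beta> i
  proof -
    have "det_form k V b (\<beta>(i := \<alpha>)) = (\<Sum>p | p permutes {..<k}.
        of_int (sign p) * (\<alpha> (b (p i)) * (\<Prod>j\<in>{..<k} - {i}. \<beta> j (b (p j)))))"
      if \<alpha>: "\<alpha> \<in> dual V" for \<alpha>
    proof -
      have "\<beta>(i := \<alpha>) \<in> {..<k} \<rightarrow>\<^sub>E dual V"
        using \<beta> i \<alpha> by (auto simp: PiE_def extensional_def Pi_def)
      moreover have "(\<Prod>j<k. (\<beta>(i := \<alpha>)) j (b (p j))) =
          \<alpha> (b (p i)) * (\<Prod>j\<in>{..<k} - {i}. \<beta> j (b (p j)))" for p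
        using i by (subst prod.remove[of _ i]) auto
      ultimately show ?thesis
        unfolding det_form_def by simp
    qed
    then show ?thesis
      unfolding linear_on_def
      by (simp add: subspace_add[OF subspace_dual] subspace_scale[OF subspace_dual] algebra_simps
          sum.distrib) (simp add: scaleR_fun_def sum_distrib_left ac_simps)
  qed
  moreover have "det_form k V b \<beta> = 0"
    if \<beta>: "\<beta> \<in> {..<k} \<rightarrow>\<^sub>E dual V" and ij: "i < k" "j < k" "i \<noteq> j" "\<beta> i = \<beta> j" for \<beta> i j
  proof -
    let ?t = "Transposition.transpose i j"
    let ?s = "\<lambda>p. of_int (sign p) * (\<Prod>i<k. \<beta> i (b (p i)))"
    have t: "?t permutes {..<k}"
      using ij by (intro permutes_swap_id) auto
    have \<beta>t: "\<beta> (?t l) = \<beta> l" for l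
      using ij by (auto simp: Transposition.transpose_def)
    have "?s (p \<circ> ?t) = - ?s p" if p: "p permutes {..<k}" for p
    proof -
      have "sign (p \<circ> ?t) = - sign p"
        using ij p t
        by (subst sign_compose) (auto simp: sign_swap_id intro: permutes_imp_permutation)
      moreover have "(\<Prod>l<k. \<beta> l (b ((p \<circ> ?t) l))) = (\<Prod>l<k. \<beta> (?t l) (b (p (?t l))))"
        by (simp add: \<beta>t)
      moreover have "\<dots> = (\<Prod>l<k. \<beta> l (b (p l)))"
        using prod.permute[OF t, of "\<lambda>l. \<beta> l (b (p l))"] by (simp add: o_def)
      ultimately show ?thesis
        by simp
    qed
    then have "(\<Sum>p | p permutes {..<k}. ?s (p \<circ> ?t)) = - (\<Sum>p | p permutes {..<k}. ?s p)"
      by (simp add: sum_negf)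
    moreover have "(\<Sum>p | p permutes {..<k}. ?s p) = (\<Sum>p | p permutes {..<k}. ?s (p \<circ> ?t))"
      by (rule sum_permutations_compose_right[OF t])
    ultimately show ?thesis
      using \<beta> by (simp add: det_form_def)
  qed
  moreover have "det_form k V b \<beta> = 0" if "\<beta> \<notin> {..<k} \<rightarrow>\<^sub>E dual V" for \<beta>
    using that by (simp add: det_form_def)
  ultimately show ?thesis
    unfolding ext_power_def by blast
qed

text \<open>The determinant of the identity matrix: a permutation that moves some \<open>i\<close>
  picks up the off-diagonal entry at \<open>i\<close> and \<open>p i\<close>, which is 0.\<close>

lemma det_form_dual_basis:
  assumes "\<beta> \<in> {..<k} \<rightarrow>\<^sub>E dual V" "\<And>i j. i < k \<Longrightarrow> j < k \<Longrightarrow> \<beta> i (b j) = (if i = j then 1 else 0)"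
  shows "det_form k V b \<beta> = 1"
proof -
  have "(\<Sum>p | p permutes {..<k}. of_int (sign p) * (\<Prod>i<k. \<beta> i (b (p i)))) =
      (\<Sum>p\<in>{id}. of_int (sign p) * (\<Prod>i<k. \<beta> i (b (p i))))"
  proof (rule sum.mono_neutral_right)
    show "\<forall>p\<in>{p. p permutes {..<k}} - {id}. of_int (sign p) * (\<Prod>i<k. \<beta> i (b (p i))) = 0"
    proof
      fix p assume "p \<in> {p. p permutes {..<k}} - {id}"
      then have p: "p permutes {..<k}" and "p \<noteq> id" by auto
      then obtain i where i: "p i \<noteq> i" by (auto simp: fun_eq_iff)
      then have "i < k" "p i < k"
        using p permutes_not_in[OF p] permutes_in_image[OF p] by (metis lessThan_iff)+
      then have "\<exists>i\<in>{..<k}. \<beta> i (b (p i)) = 0"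
        using i assms(2)[of i "p i"] by auto
      then have "(\<Prod>i<k. \<beta> i (b (p i))) = 0"
        by simp
      then show "of_int (sign p) * (\<Prod>i<k. \<beta> i (b (p i))) = 0"
        by simp
    qed
  qed (auto simp: finite_permutations permutes_id)
  then show ?thesis
    using assms by (simp add: det_form_def)
qed

text \<open>If \<open>L\<close> is injective, the vectors \<open>L (b i)\<close> have a dual family
  in \<open>dual W\<close>, and the image of the determinant form of \<open>b\<close> takes the
  value 1 on it. If \<open>L\<close> kills some nonzero \<open>\<xi>\<close>, every functional
  pulled back along \<open>L\<close> vanishes at \<open>\<xi>\<close>. Such functionals form a
  proper subspace of the \<open>k\<close>-dimensional space \<open>dual V\<close>, so any
  \<open>k\<close> of them are dependent.\<close>

lemma ext_map_eq_0_iff: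
  assumes b: "is_basis k b V" and W: "subspace W" and L: "L \<in> Hom V W"
  shows "ext_map k V W L = 0 \<longleftrightarrow> (\<exists>\<xi>\<in>V. \<xi> \<noteq> 0 \<and> L \<xi> = 0)"
proof -
  have V: "subspace V" "\<And>i. i < k \<Longrightarrow> b i \<in> V"
    by (rule is_basisD[OF b])+
  have linL: "linear_on V L"
    using L by (simp add: Hom_def)
  show ?thesis
  proof
    assume zero: "ext_map k V W L = 0"
    show "\<exists>\<xi>\<in>V. \<xi> \<noteq> 0 \<and> L \<xi> = 0"
    proof (rule ccontr)
      assume "\<not> ?thesis"
      then have ker: "\<xi> = 0" if "\<xi> \<in> V" "L \<xi> = 0" for \<xi>
        using that by blast
      have Lsum: "L (\<Sum>i<k. c i *\<^sub>R b i) = (\<Sum>i<k. c i *\<^sub>R L (b i))" for c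
        using V by (intro linear_on_sum[OF V(1) linL]) auto
      have inV: "(\<Sum>i<k. c i *\<^sub>R b i) \<in> V" for c
        using V by (intro subspace_sum subspace_scale) auto
      have c0: "c i = 0" if "(\<Sum>i<k. c i *\<^sub>R L (b i)) = 0" "i < k" for c i
      proof -
        have "(\<Sum>i<k. c i *\<^sub>R b i) = 0"
          using that(1) by (intro ker inV) (simp add: Lsum)
        then show ?thesis
          using that(2) by (rule is_basis_unique[OF b])
      qed
      have inj: "inj_on (\<lambda>i. L (b i)) {..<k}"
      proof (rule inj_onI, rule ccontr)
        fix i j assume ij: "i \<in> {..<k}" "j \<in> {..<k}" "L (b i) = L (b j)" "i \<noteq> j"
        \<comment> \<open>The equality \<open>L (b i) = L (b j)\<close> written as a linear
          relation; its coefficient at \<open>i\<close> is 1.\<close>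
        have "(\<Sum>l<k. ((if i = l then 1 else 0) - (if j = l then 1 else 0)) *\<^sub>R L (b l)) = 0"
          using ij by (simp add: scaleR_diff_left sum_subtractf sum_kronecker del: scaleR_left.diff)
        from c0[OF this, of i] ij show False by simp
      qed
      have ind: "independent ((\<lambda>i. L (b i)) ` {..<k})"
      proof (rule independent_if_scalars_zero)
        fix u w assume "(\<Sum>w\<in>(\<lambda>i. L (b i)) ` {..<k}. u w *\<^sub>R w) = 0"
          and "w \<in> (\<lambda>i. L (b i)) ` {..<k}"
        then show "u w = 0"
          using c0[of "\<lambda>i. u (L (b i))"] inj by (auto simp: sum.reindex)
      qed simp
      have "(\<lambda>i. L (b i)) ` {..<k} \<subseteq> W"
        using L V(2) by (auto simp: Hom_def)
      from independent_dual_family[OF W inj ind this] obtain \<beta>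
        where \<beta>: "\<forall>i<k. \<beta> i \<in> dual W"
          "\<forall>i<k. \<forall>j<k. \<beta> i (L (b j)) = (if i = j then 1 else (0::real))"
        by blast
      \<comment> \<open>\<open>ext_map\<close> is 0 by default at tuples outside \<open>PiE\<close>,
        so the values beyond \<open>k\<close> must be made undefined.\<close>
      define \<beta>' where "\<beta>' = (\<lambda>i\<in>{..<k}. \<beta> i)"
      have \<beta>': "\<beta>' \<in> {..<k} \<rightarrow>\<^sub>E dual W"
        using \<beta>(1) by (auto simp: \<beta>'_def)
      have "det_form k V b (\<lambda>i\<in>{..<k}. dual_map V L (\<beta>' i)) = 1"
      proof (rule det_form_dual_basis)
        show "(\<lambda>i\<in>{..<k}. dual_map V L (\<beta>' i)) \<in> {..<k} \<rightarrow>\<^sub>E dual V"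
          using \<beta>' by (auto intro!: dual_map_in_dual[OF V(1) L])
        show "(\<lambda>i\<in>{..<k}. dual_map V L (\<beta>' i)) i (b j) = (if i = j then 1 else 0)"
          if "i < k" "j < k" for i j
          using that \<beta>(2) V(2) by (simp add: \<beta>'_def dual_map_def)
      qed
      then have "ext_map k V W L (det_form k V b) \<beta>' = 1"
        using \<beta>' det_form_in_ext_power by (auto simp: ext_map_def)
      then show False
        using zero by (simp add: zero_fun_def)
    qed
  next
    assume "\<exists>\<xi>\<in>V. \<xi> \<noteq> 0 \<and> L \<xi> = 0"
    then obtain \<xi> where \<xi>: "\<xi> \<in> V" "\<xi> \<noteq> 0" "L \<xi> = 0" by blast
    obtain \<theta> where \<theta>: "\<And>i. i < k \<Longrightarrow> \<theta> i \<in> dual V"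
        "\<And>i j. i < k \<Longrightarrow> j < k \<Longrightarrow> \<theta> i (b j) = (if i = j then 1 else (0::real))"
        "is_basis k \<theta> (dual V)"
      using dual_basis[OF b] by blast
    obtain c where c: "\<xi> = (\<Sum>i<k. c i *\<^sub>R b i)"
      using is_basis_expand[OF b \<xi>(1)] .
    have "\<theta> i \<xi> = c i" if "i < k" for i
    proof -
      have "\<theta> i \<xi> = (\<Sum>j<k. c j * \<theta> i (b j))"
        unfolding c using V \<theta>(1) that by (intro dual_sum) auto
      also have "\<dots> = (\<Sum>j<k. (if i = j then 1 else 0) *\<^sub>R c j)"
        using \<theta>(2) that by (intro sum.cong) auto
      finally show ?thesis
        using that by (simp only: sum_kronecker)
    qed
    \<comment> \<open>A nonzero coordinate of \<open>\<xi>\<close> supplies a functional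
      \<open>\<theta> m\<close> outside the subspace of functionals annihilating
      \<open>\<xi>\<close>.\<close>
    then obtain m where m: "m < k" "\<theta> m \<xi> \<noteq> 0"
      using c \<xi>(2) by (metis (no_types, lifting) lessThan_iff scaleR_zero_left sum.neutral)
    have "\<omega> (\<lambda>i\<in>{..<k}. dual_map V L (\<beta> i)) = 0"
      if \<omega>: "\<omega> \<in> ext_power k V" and \<beta>: "\<beta> \<in> {..<k} \<rightarrow>\<^sub>E dual W" for \<omega> \<beta>
    proof (rule ext_power_dependent[OF \<omega>])
      let ?\<gamma> = "\<lambda>i\<in>{..<k}. dual_map V L (\<beta> i)"
      show \<gamma>: "?\<gamma> \<in> {..<k} \<rightarrow>\<^sub>E dual V"
        using \<beta> dual_map_in_dual[OF V(1) L] by auto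
      show "\<not> (inj_on ?\<gamma> {..<k} \<and> independent (?\<gamma> ` {..<k}))"
      proof
        assume "inj_on ?\<gamma> {..<k} \<and> independent (?\<gamma> ` {..<k})"
        then have inj: "inj_on ?\<gamma> {..<k}" and ind: "independent (?\<gamma> ` {..<k})"
          by auto
        have "\<beta> i 0 = 0" if "i < k" for i
          using dual_sum[OF W, of "\<beta> i" "{}"] \<beta> that by auto
        then have "?\<gamma> ` {..<k} \<subseteq> {\<gamma>. \<gamma> \<xi> = 0}"
          using \<xi> by (auto simp: dual_map_def)
        moreover have "subspace {\<gamma> :: 'a \<Rightarrow> real. \<gamma> \<xi> = 0}"
          by (auto simp: subspace_def scaleR_fun_def)
        ultimately have "span (?\<gamma> ` {..<k}) \<subseteq> {\<gamma>. \<gamma> \<xi> = 0}"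
          by (rule span_minimal)
        then have notin: "\<theta> m \<notin> span (?\<gamma> ` {..<k})"
          using m by auto
        \<comment> \<open>If the \<open>k\<close> pulled-back functionals were independent,
          adjoining \<open>\<theta> m\<close> would give \<open>k + 1\<close> independent elements
          in the span of the \<open>k\<close> elements of the dual basis.\<close>
        then have "independent (insert (\<theta> m) (?\<gamma> ` {..<k}))"
          using ind by (simp add: independent_insertI)
        moreover have "insert (\<theta> m) (?\<gamma> ` {..<k}) \<subseteq> span (\<theta> ` {..<k})"
        proof -
          have "span (\<theta> ` {..<k}) = dual V"
            using \<theta>(3) by (simp add: is_basis_def)
          moreover have "?\<gamma> ` {..<k} \<subseteq> dual V"
            using \<gamma> by (intro image_subsetI) (rule PiE_mem)
          ultimately show ?thesis
            using \<theta>(1)[OF m(1)] by blast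
        qed
        ultimately have "card (insert (\<theta> m) (?\<gamma> ` {..<k})) \<le> card (\<theta> ` {..<k})"
          using independent_span_bound[of "\<theta> ` {..<k}"] by blast
        moreover have "\<theta> m \<notin> ?\<gamma> ` {..<k}"
          using notin by (rule contrapos_nn) (rule span_base)
        then have "card (insert (\<theta> m) (?\<gamma> ` {..<k})) = Suc k"
          using card_image[OF inj]
          by (metis card_insert_disjoint card_lessThan finite_imageI finite_lessThan)
        moreover have "card (\<theta> ` {..<k}) \<le> k"
          using card_image_le[of "{..<k}" \<theta>] by simp
        ultimately show False by linarith
      qed
    qed
    then show "ext_map k V W L = 0"
      unfolding ext_map_def by (intro ext) (simp add: zero_fun_def)
  qed
qed

section \<open>Smooth functions\<close>

lemma Ck_on_subset:
  assumes "T \<subseteq> S" "Ck_on n S f"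
  shows "Ck_on n T f"
  using assms(2)
proof (induction n arbitrary: f)
  case 0
  then show ?case using assms(1) by (auto intro: continuous_on_subset)
next
  case (Suc n)
  then show ?case using assms(1) by auto
qed

text \<open>Since \<open>S\<close> is open, \<open>f\<close> and \<open>g\<close> agree near each of
  its points, so their derivatives agree there too. The lemma lets the rules below use derivative
  formulas that are known only on \<open>S\<close>.\<close>

lemma Ck_on_cong:
  assumes "open S" "\<And>x. x \<in> S \<Longrightarrow> f x = g x" "Ck_on n S f"
  shows "Ck_on n S g"
  using assms(2,3)
proof (induction n arbitrary: f g)
  case 0
  then show ?case by (simp cong: continuous_on_cong)
next
  case (Suc n)
  have diff: "f differentiable (at x)" if "x \<in> S" for x
    using Suc.prems that by simp
  have "g differentiable (at x)" if "x \<in> S" for x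
    using diff[OF that] assms(1) that Suc.prems(1) unfolding differentiable_def
    by (meson has_derivative_transform_within_open)
  moreover have "frechet_derivative f (at x) = frechet_derivative g (at x)" if "x \<in> S" for x
    using diff[OF that] assms(1) that Suc.prems(1)
    by (rule frechet_derivative_transform_within_open)
  moreover have "Ck_on n S (\<lambda>x. frechet_derivative f (at x) v)" for v
    using Suc.prems by simp
  ultimately show ?case
    using Suc.IH[of "\<lambda>x. frechet_derivative f (at x) v" "\<lambda>x. frechet_derivative g (at x) v" for v]
    by simp
qed

text \<open>Wanted for the product rule, where the undifferentiated factors reappear and are needed
  one order lower.\<close>

lemma Ck_on_Suc_imp: "Ck_on (Suc n) S f \<Longrightarrow> Ck_on n S f"
proof (induction n arbitrary: f)
  case 0
  then show ?case
    by (auto intro!: continuous_at_imp_continuous_on differentiable_imp_continuous_within)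
next
  case (Suc n)
  then show ?case by (metis Ck_on.simps(2))
qed

lemma Ck_on_const: "Ck_on n S (\<lambda>x. c)"
  by (induction n arbitrary: c) auto

lemma Ck_on_add:
  assumes "open S" "Ck_on n S f" "Ck_on n S g"
  shows "Ck_on n S (\<lambda>x. f x + g x)"
  using assms(2,3)
proof (induction n arbitrary: f g)
  case 0
  then show ?case by (auto intro: continuous_on_add)
next
  case (Suc n)
  have "Ck_on n S (\<lambda>x. frechet_derivative (\<lambda>x. f x + g x) (at x) v)" for v
  proof (rule Ck_on_cong[OF assms(1)])
    show "Ck_on n S (\<lambda>x. frechet_derivative f (at x) v + frechet_derivative g (at x) v)"
      using Suc by simp
    fix x assume "x \<in> S"
    then have "(f has_derivative frechet_derivative f (at x)) (at x)"
      "(g has_derivative frechet_derivative g (at x)) (at x)"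
      using Suc.prems by (auto simp: frechet_derivative_works[symmetric])
    from frechet_derivative_at[OF has_derivative_add[OF this]]
    show "frechet_derivative f (at x) v + frechet_derivative g (at x) v =
        frechet_derivative (\<lambda>x. f x + g x) (at x) v"
      by metis
  qed
  then show ?case using Suc.prems by simp
qed

text \<open>The derivative of the product is a sum of two products of C^n functions, so the
  induction hypothesis must hold for arbitrary factors.\<close>

lemma Ck_on_mult:
  fixes f g :: "'a::real_normed_vector \<Rightarrow> real"
  assumes "open S" "Ck_on n S f" "Ck_on n S g"
  shows "Ck_on n S (\<lambda>x. f x * g x)"
  using assms(2,3)
proof (induction n arbitrary: f g)
  case 0
  then show ?case by (auto intro: continuous_on_mult)
next
  case (Suc n)
  have "Ck_on n S (\<lambda>x. frechet_derivative (\<lambda>x. f x * g x) (at x) v)" for v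
  proof (rule Ck_on_cong[OF assms(1)])
    show "Ck_on n S (\<lambda>x. f x * frechet_derivative g (at x) v + frechet_derivative f (at x) v * g x)"
      using Suc.prems by (intro Ck_on_add[OF assms(1)] Suc.IH) (simp_all add: Ck_on_Suc_imp del: Ck_on.simps, simp_all)
    fix x assume "x \<in> S"
    then have "(f has_derivative frechet_derivative f (at x)) (at x)"
      "(g has_derivative frechet_derivative g (at x)) (at x)"
      using Suc.prems by (auto simp: frechet_derivative_works[symmetric])
    from frechet_derivative_at[OF has_derivative_mult[OF this]]
    show "f x * frechet_derivative g (at x) v + frechet_derivative f (at x) v * g x =
        frechet_derivative (\<lambda>x. f x * g x) (at x) v"
      by metis
  qed
  then show ?case using Suc.prems by simp
qed

section \<open>Smooth functions on a manifold, read in charts\<close>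

lemma smooth_manifold_chart:
  assumes "smooth_manifold M" "(V, c) \<in> charts M"
  shows "openin (mtop M) V" "open (c ` V)"
    "homeomorphic_map (subtopology (mtop M) V) (top_of_set (c ` V)) c"
  using assms unfolding smooth_manifold_def by blast+

lemma inv_into_chart:
  assumes "smooth_manifold M" "(V, c) \<in> charts M" "x \<in> V"
  shows "inv_into V c (c x) = x"
proof -
  have "openin (mtop M) V" and h: "homeomorphic_map (subtopology (mtop M) V) (top_of_set (c ` V)) c"
    using smooth_manifold_chart[OF assms(1,2)] by auto
  then have "inj_on c V"
    using homeomorphic_imp_injective_map[OF h] openin_subset[of "mtop M" V]
    by (simp add: Int_absorb1)
  then show ?thesis
    using assms(3) by simp
qed

text \<open>Supplies the openness on which the sum and product rules rely when they are applied in a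
  chart.\<close>

lemma open_chart_image:
  assumes M: "smooth_manifold M" "(V, c) \<in> charts M" and U: "openin (mtop M) U"
  shows "open (c ` (U \<inter> V))"
proof -
  have "openin (subtopology (mtop M) V) (U \<inter> V)"
    using U by (auto simp: openin_subtopology)
  moreover have "open_map (subtopology (mtop M) V) (top_of_set (c ` V)) c"
    using smooth_manifold_chart(3)[OF M] by (rule homeomorphic_imp_open_map)
  ultimately have "openin (top_of_set (c ` V)) (c ` (U \<inter> V))"
    by (simp add: open_map_def)
  then show ?thesis
    using smooth_manifold_chart(2)[OF M] by (rule openin_open_trans)
qed

lemma smooth_fun_subset:
  assumes "smooth_fun M U h" "openin (mtop M) V" "V \<subseteq> U"
  shows "smooth_fun M V h"
  using assms unfolding smooth_fun_def smooth_on_def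
  by (fastforce intro: Ck_on_subset[of "_ ` (V \<inter> _)" "_ ` (U \<inter> _)"])

lemma smooth_fun_const: "openin (mtop M) U \<Longrightarrow> smooth_fun M U (\<lambda>x. r)"
  by (auto simp: smooth_fun_def smooth_on_def o_def Ck_on_const)

lemma smooth_fun_add:
  assumes "smooth_manifold M" "smooth_fun M U g" "smooth_fun M U h"
  shows "smooth_fun M U (\<lambda>x. g x + h x)"
  using assms(2,3) open_chart_image[OF assms(1)]
  by (fastforce simp: smooth_fun_def smooth_on_def o_def intro: Ck_on_add)

lemma smooth_fun_mult:
  assumes "smooth_manifold M" "smooth_fun M U g" "smooth_fun M U h"
  shows "smooth_fun M U (\<lambda>x. g x * h x)"
  using assms(2,3) open_chart_image[OF assms(1)]
  by (fastforce simp: smooth_fun_def smooth_on_def o_def intro: Ck_on_mult)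

lemma smooth_fun_diff:
  assumes "smooth_manifold M" "smooth_fun M U g" "smooth_fun M U h"
  shows "smooth_fun M U (\<lambda>x. g x - h x)"
proof -
  have "openin (mtop M) U"
    using assms(2) by (simp add: smooth_fun_def)
  then have "smooth_fun M U (\<lambda>x. g x + (-1) * h x)"
    using assms by (intro smooth_fun_add smooth_fun_mult smooth_fun_const)
  then show ?thesis by simp
qed

lemma smooth_fun_sum:
  assumes "smooth_manifold M" "openin (mtop M) U" "\<And>i. i \<in> I \<Longrightarrow> smooth_fun M U (h i)"
  shows "smooth_fun M U (\<lambda>x. \<Sum>i\<in>I. h i x)"
  using assms(3)
  by (induction I rule: infinite_finite_induct)
    (simp_all add: smooth_fun_const assms(2) smooth_fun_add[OF assms(1)])

text \<open>This is what makes the set where a pivot is nonzero open. Near a point of a chart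
  domain, \<open>h\<close> is its coordinate expression after the chart map; the former is
  continuous as the case \<open>n = 0\<close> of \<open>Ck_on\<close>.\<close>

lemma smooth_fun_continuous:
  assumes M: "smooth_manifold M" and h: "smooth_fun M U h"
  shows "continuous_map (subtopology (mtop M) U) euclideanreal h"
proof -
  have U: "openin (mtop M) U"
    using h by (simp add: smooth_fun_def)
  have "openin (mtop M) {x \<in> U. h x \<in> T}" if T: "open T" for T
  proof (subst openin_subopen, safe)
    fix x assume x: "x \<in> U" "h x \<in> T"
    then have "x \<in> points M"
      using U openin_subset by blast
    then obtain V c where V: "(V, c) \<in> charts M" "x \<in> V"
      using M unfolding smooth_manifold_def by blast
    note chart = smooth_manifold_chart[OF M V(1)]
    have cont: "continuous_map (subtopology (mtop M) V) (top_of_set (c ` V)) c"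
      using chart(3) by (rule homeomorphic_imp_continuous_map)
    have op: "open (c ` (U \<inter> V))"
      by (rule open_chart_image[OF M V(1) U])
    have "Ck_on 0 (c ` (U \<inter> V)) (h \<circ> inv_into V c)"
      using h V(1) unfolding smooth_fun_def smooth_on_def by blast
    then have "open ((h \<circ> inv_into V c) -` T \<inter> c ` (U \<inter> V))"
      using T unfolding Ck_on.simps continuous_on_open_vimage[OF op] by blast
    then have "openin (top_of_set (c ` V)) ((h \<circ> inv_into V c) -` T \<inter> c ` (U \<inter> V))"
      by (subst openin_open_eq[OF chart(2)]) auto
    from openin_continuous_map_preimage[OF cont this]
    have "openin (subtopology (mtop M) V) {y \<in> topspace (subtopology (mtop M) V).
        c y \<in> (h \<circ> inv_into V c) -` T \<inter> c ` (U \<inter> V)}" .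
    \<comment> \<open>Pulling the preimage back through the chart returns the preimage under
      \<open>h\<close> itself, because \<open>c\<close> is injective on \<open>V\<close>.\<close>
    moreover have "{y \<in> topspace (subtopology (mtop M) V).
        c y \<in> (h \<circ> inv_into V c) -` T \<inter> c ` (U \<inter> V)} = {y \<in> U \<inter> V. h y \<in> T}"
    proof -
      have inv: "inv_into V c (c y) = y" if "y \<in> V" for y
        using that by (rule inv_into_chart[OF M V(1)])
      have "c y \<in> c ` (U \<inter> V) \<longleftrightarrow> y \<in> U" if "y \<in> V" for y
      proof
        assume "c y \<in> c ` (U \<inter> V)"
        then obtain z where "z \<in> U" "z \<in> V" "c y = c z" by blast
        then show "y \<in> U"
          using inv[of z] inv[OF that] by simp
      qed (use that in blast)
      then have "c y \<in> (h \<circ> inv_into V c) -` T \<inter> c ` (U \<inter> V) \<longleftrightarrow> y \<in> U \<and> h y \<in> T"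
        if "y \<in> V" for y
        using inv that by (simp add: conj_commute)
      then have "{y \<in> V. c y \<in> (h \<circ> inv_into V c) -` T \<inter> c ` (U \<inter> V)} =
          {y \<in> V. y \<in> U \<and> h y \<in> T}"
        by (intro Collect_cong conj_cong refl)
      then show ?thesis
        unfolding topspace_subtopology_subset[OF openin_subset[OF chart(1)]] by auto
    qed
    ultimately have "openin (mtop M) {y \<in> U \<inter> V. h y \<in> T}"
      using openin_trans_full[OF _ chart(1)] by simp
    then show "\<exists>W. openin (mtop M) W \<and> x \<in> W \<and> W \<subseteq> {x \<in> U. h x \<in> T}"
      using x V(2) by (intro exI[of _ "{y \<in> U \<inter> V. h y \<in> T}"]) auto
  qed
  then show ?thesis
    using U unfolding continuous_map_def topspace_subtopology_subset[OF openin_subset[OF U]]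
    by (auto simp: openin_open_subtopology)
qed


section \<open>Linearly dependent rows of matrices of functions\<close>

text \<open>The rows form a set, since elimination removes an arbitrary pivot row. The columns form
  an initial segment, since each step clears the last one, which has index \<open>m\<close> among
  \<open>Suc m\<close> columns.\<close>

definition rows_dependent :: "'i set \<Rightarrow> nat \<Rightarrow> ('i \<Rightarrow> nat \<Rightarrow> real) \<Rightarrow> bool"
  where "rows_dependent I m a \<longleftrightarrow>
    (\<exists>c. (\<exists>i\<in>I. c i \<noteq> 0) \<and> (\<forall>j<m. (\<Sum>i\<in>I. c i * a i j) = 0))"

text \<open>A step of Gaussian elimination with pivot \<open>a p m\<close>. It is scaled to avoid division, so that
  smoothness in a parameter only needs sums and products.\<close>

definition eliminate :: "'i \<Rightarrow> nat \<Rightarrow> ('i \<Rightarrow> nat \<Rightarrow> real) \<Rightarrow> 'i \<Rightarrow> nat \<Rightarrow> real"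
  where "eliminate p m a i j = a p m * a i j - a i m * a p j"

text \<open>Back substitution. In the combination with coefficients \<open>c\<close> of the
  eliminated rows, the original row \<open>i\<close> occurs with the factor
  \<open>a p m * c i\<close>, and the subtracted multiples of the pivot row collect into the
  coefficient at \<open>p\<close>.\<close>

definition uneliminate :: "'i set \<Rightarrow> 'i \<Rightarrow> nat \<Rightarrow> ('i \<Rightarrow> nat \<Rightarrow> real) \<Rightarrow> ('i \<Rightarrow> real) \<Rightarrow> 'i \<Rightarrow> real"
  where "uneliminate I p m a c i =
    (if i = p then - (\<Sum>l\<in>I - {p}. c l * a l m) else a p m * c i)"

text \<open>Regrouping the terms is an identity in the entries. The assumption covers the columns
  below \<open>m\<close>; column \<open>m\<close> comes for free because \<open>eliminate\<close>
  makes it identically zero.\<close>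

lemma uneliminate_relation:
  assumes I: "finite I" "p \<in> I"
    and c: "\<And>j. j < m \<Longrightarrow> (\<Sum>i\<in>I - {p}. c i * eliminate p m a i j) = 0" and j: "j < Suc m"
  shows "(\<Sum>i\<in>I. uneliminate I p m a c i * a i j) = 0"
proof -
  have "(\<Sum>i\<in>I. uneliminate I p m a c i * a i j) =
      uneliminate I p m a c p * a p j + (\<Sum>i\<in>I - {p}. uneliminate I p m a c i * a i j)"
    using I by (rule sum.remove)
  also have "\<dots> = (\<Sum>i\<in>I - {p}. c i * eliminate p m a i j)"
    by (simp add: uneliminate_def eliminate_def sum_distrib_left sum_subtractf algebra_simps
        cong: sum.cong_simp)
  also have "\<dots> = 0"
    using c j by (cases "j = m") (auto simp: eliminate_def)
  finally show ?thesis .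
qed

text \<open>A relation restricts to the rows other than \<open>p\<close>. It stays nontrivial
  because a nonzero pivot forces \<open>c p = 0\<close> as soon as all other coefficients vanish. In
  the other direction, back substitution multiplies the surviving coefficients by the nonzero
  pivot.\<close>

lemma rows_dependent_eliminate:
  assumes I: "finite I" "p \<in> I" and pivot: "a p m \<noteq> 0"
  shows "rows_dependent I (Suc m) a \<longleftrightarrow> rows_dependent (I - {p}) m (eliminate p m a)"
proof
  assume "rows_dependent I (Suc m) a"
  then obtain c where c: "\<exists>i\<in>I. c i \<noteq> 0" "\<And>j. j < Suc m \<Longrightarrow> (\<Sum>i\<in>I. c i * a i j) = 0"
    unfolding rows_dependent_def by blast
  have split: "(\<Sum>i\<in>I - {p}. c i * a i j) = - (c p * a p j)" if "j < Suc m" for j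
    using c(2)[OF that] sum.remove[OF I, of "\<lambda>i. c i * a i j"] by simp
  have "\<exists>i\<in>I - {p}. c i \<noteq> 0"
  proof (rule ccontr)
    assume "\<not> ?thesis"
    then have z: "\<And>i. i \<in> I - {p} \<Longrightarrow> c i = 0" by blast
    then have "c p * a p m = 0"
      using split[of m] by simp
    then show False
      using z c(1) pivot by auto
  qed
  moreover have "(\<Sum>i\<in>I - {p}. c i * eliminate p m a i j) = 0" if "j < m" for j
  proof -
    \<comment> \<open>By \<open>split\<close>, the two sums are \<open>- (c p * a p j)\<close> and
      \<open>- (c p * a p m)\<close>, so the two products cancel.\<close>
    have "(\<Sum>i\<in>I - {p}. c i * eliminate p m a i j) =
        a p m * (\<Sum>i\<in>I - {p}. c i * a i j) - a p j * (\<Sum>i\<in>I - {p}. c i * a i m)"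
      by (simp add: eliminate_def sum_distrib_left sum_subtractf algebra_simps)
    then show ?thesis
      using that by (simp add: split)
  qed
  ultimately show "rows_dependent (I - {p}) m (eliminate p m a)"
    unfolding rows_dependent_def by blast
next
  assume "rows_dependent (I - {p}) m (eliminate p m a)"
  then obtain c where c: "\<exists>i\<in>I - {p}. c i \<noteq> 0"
      "\<And>j. j < m \<Longrightarrow> (\<Sum>i\<in>I - {p}. c i * eliminate p m a i j) = 0"
    unfolding rows_dependent_def by blast
  have "\<exists>i\<in>I. uneliminate I p m a c i \<noteq> 0"
    using c(1) pivot by (auto simp: uneliminate_def)
  then show "rows_dependent I (Suc m) a"
    unfolding rows_dependent_def using uneliminate_relation[OF I c(2)] by blast
qed

lemma rows_dependent_mono:
  "rows_dependent I m a \<Longrightarrow> n \<le> m \<Longrightarrow> rows_dependent I n a"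
  unfolding rows_dependent_def by (meson less_le_trans)

lemma rows_dependent_zero_column:
  assumes "\<And>i. i \<in> I \<Longrightarrow> a i m = 0"
  shows "rows_dependent I (Suc m) a \<longleftrightarrow> rows_dependent I m a"
  unfolding rows_dependent_def using assms by (auto simp: less_Suc_eq)

lemma openin_pivot:
  assumes "continuous_map X euclideanreal f"
  shows "openin X {x \<in> topspace X. f x \<noteq> 0}"
  using openin_continuous_map_preimage[OF assms, of "- {0}"] by (simp add: open_Compl)

text \<open>Induction on the number of columns. A pivot that is nonzero at \<open>x\<close> stays
  nonzero near \<open>x\<close>, and there independence is equivalent to independence of the
  eliminated matrix.\<close>

lemma rows_independent_openin:
  assumes "finite I" "\<And>i j. i \<in> I \<Longrightarrow> j < m \<Longrightarrow> continuous_map X euclideanreal (a i j)"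
    and "x \<in> topspace X" "\<not> rows_dependent I m (\<lambda>i j. a i j x)"
  shows "\<exists>W. openin X W \<and> x \<in> W \<and> (\<forall>y\<in>W. \<not> rows_dependent I m (\<lambda>i j. a i j y))"
  using assms
proof (induction m arbitrary: I a)
  case 0
  then have "I = {}"
    by (auto simp: rows_dependent_def)
  then show ?case
    using 0 by (intro exI[of _ "topspace X"]) (auto simp: rows_dependent_def)
next
  case (Suc m)
  show ?case
  proof (cases "\<forall>i\<in>I. a i m x = 0")
    case True
    \<comment> \<open>The last column vanishes at \<open>x\<close> but perhaps not nearby. This is
      harmless, as independence in the first \<open>m\<close> columns persists when a column is
      added.\<close>
    then have "\<not> rows_dependent I m (\<lambda>i j. a i j x)"
      using Suc.prems(4) rows_dependent_zero_column[of I "\<lambda>i j. a i j x" m] by blast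
    then obtain W where "openin X W" "x \<in> W" "\<forall>y\<in>W. \<not> rows_dependent I m (\<lambda>i j. a i j y)"
      using Suc.IH[OF Suc.prems(1)] Suc.prems(2,3) by (metis less_Suc_eq)
    then show ?thesis
      by (meson rows_dependent_mono le_SucI order_refl)
  next
    case False
    then obtain p where p: "p \<in> I" "a p m x \<noteq> 0" by blast
    let ?b = "\<lambda>i j x. eliminate p m (\<lambda>i j. a i j x) i j"
    have "\<not> rows_dependent (I - {p}) m (\<lambda>i j. ?b i j x)"
      using Suc.prems(4) rows_dependent_eliminate[OF Suc.prems(1) p(1), of "\<lambda>i j. a i j x"] p(2)
      by blast
    moreover have "continuous_map X euclideanreal (?b i j)" if "i \<in> I - {p}" "j < m" for i j
      unfolding eliminate_def using that p(1)
      by (intro continuous_map_diff continuous_map_real_mult Suc.prems(2)) auto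
    ultimately obtain W where W: "openin X W" "x \<in> W"
        "\<forall>y\<in>W. \<not> rows_dependent (I - {p}) m (\<lambda>i j. ?b i j y)"
      using Suc.IH[of "I - {p}" ?b] Suc.prems(1,3) by blast
    have "openin X {y \<in> topspace X. a p m y \<noteq> 0}"
      using Suc.prems(2) p(1) by (intro openin_pivot) auto
    then have "openin X (W \<inter> {y \<in> topspace X. a p m y \<noteq> 0})"
      using W(1) by blast
    moreover have "\<not> rows_dependent I (Suc m) (\<lambda>i j. a i j y)"
      if "y \<in> W \<inter> {y \<in> topspace X. a p m y \<noteq> 0}" for y
      using that W(3) rows_dependent_eliminate[OF Suc.prems(1) p(1), of "\<lambda>i j. a i j y"] by blast
    ultimately show ?thesis
      using W(2) p(2) Suc.prems(3) by blast
  qed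
qed

text \<open>Pointwise dependence is turned into a smooth relation at the price of shrinking
  \<open>W\<close>. The row set, the open set and the matrix all change in an elimination step, so
  the induction on columns generalises over all three.\<close>

lemma smooth_row_relation:
  assumes M: "smooth_manifold M" and "finite I" "openin (mtop M) W" "W \<noteq> {}"
    and "\<And>i j. i \<in> I \<Longrightarrow> j < m \<Longrightarrow> smooth_fun M W (a i j)"
    and "\<And>x. x \<in> W \<Longrightarrow> rows_dependent I m (\<lambda>i j. a i j x)"
  shows "\<exists>V c. openin (mtop M) V \<and> V \<noteq> {} \<and> V \<subseteq> W \<and> (\<forall>i\<in>I. smooth_fun M V (c i)) \<and>
    (\<forall>x\<in>V. (\<exists>i\<in>I. c i x \<noteq> 0) \<and> (\<forall>j<m. (\<Sum>i\<in>I. c i x * a i j x) = 0))"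
  using assms(2-)
proof (induction m arbitrary: I W a)
  case 0
  \<comment> \<open>With no columns left, a dependence at a point of \<open>W\<close> only says that
    a row exists, and the constant coefficients 1 will do.\<close>
  then have "I \<noteq> {}"
    by (fastforce simp: rows_dependent_def)
  then show ?case
    using 0 smooth_fun_const[of M W 1]
    by (intro exI[of _ W] exI[of _ "\<lambda>i x. 1"]) auto
next
  case (Suc m)
  show ?case
  \<comment> \<open>The case split is over all of \<open>W\<close> and not at a point: a column with
    a nonzero entry somewhere has a pivot on a nonempty open subset, even if all its entries vanish
    elsewhere.\<close>
  proof (cases "\<forall>i\<in>I. \<forall>x\<in>W. a i m x = 0")
    case True
    have dep: "rows_dependent I m (\<lambda>i j. a i j x)" if "x \<in> W" for x
      using rows_dependent_mono[OF Suc.prems(5)[OF that]] by simp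
    have "\<exists>V c. openin (mtop M) V \<and> V \<noteq> {} \<and> V \<subseteq> W \<and> (\<forall>i\<in>I. smooth_fun M V (c i)) \<and>
        (\<forall>x\<in>V. (\<exists>i\<in>I. c i x \<noteq> 0) \<and> (\<forall>j<m. (\<Sum>i\<in>I. c i x * a i j x) = 0))"
      using Suc.prems dep by (intro Suc.IH) auto
    then obtain V c where V: "openin (mtop M) V" "V \<noteq> {}" "V \<subseteq> W"
      and c: "\<forall>i\<in>I. smooth_fun M V (c i)"
        "\<forall>x\<in>V. (\<exists>i\<in>I. c i x \<noteq> 0) \<and> (\<forall>j<m. (\<Sum>i\<in>I. c i x * a i j x) = 0)"
      by blast
    have "(\<Sum>i\<in>I. c i x * a i m x) = 0" if "x \<in> V" for x
      using True V(3) that by (intro sum.neutral) auto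
    then show ?thesis
      using V c by (intro exI[of _ V] exI[of _ c]) (auto simp: less_Suc_eq)
  next
    case False
    then obtain p x0 where p: "p \<in> I" "x0 \<in> W" "a p m x0 \<noteq> 0" by blast
    define W' where "W' = {x \<in> W. a p m x \<noteq> 0}"
    have "openin (subtopology (mtop M) W) W'"
      using openin_pivot[OF smooth_fun_continuous[OF M Suc.prems(4)], of p m] p(1)
        topspace_subtopology_subset[OF openin_subset[OF Suc.prems(2)]]
      by (simp only: W'_def lessI)
    then have W': "openin (mtop M) W'" "W' \<noteq> {}" "W' \<subseteq> W"
      using openin_trans_full[OF _ Suc.prems(2)] p by (auto simp: W'_def)
    have a: "smooth_fun M V (a i j)" if "openin (mtop M) V" "V \<subseteq> W'" "i \<in> I" "j < Suc m" for V i j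
      using smooth_fun_subset[OF Suc.prems(4)] that W'(3) by blast
    let ?b = "\<lambda>i j x. eliminate p m (\<lambda>i j. a i j x) i j"
    have dep: "rows_dependent (I - {p}) m (\<lambda>i j. ?b i j x)" if "x \<in> W'" for x
      using that Suc.prems(5)[of x] W'_def
        rows_dependent_eliminate[OF Suc.prems(1) p(1), of "\<lambda>i j. a i j x"] by blast
    have smooth: "smooth_fun M W' (?b i j)" if "i \<in> I - {p}" "j < m" for i j
      unfolding eliminate_def using that p(1) W'(1)
      by (intro smooth_fun_diff smooth_fun_mult M a) auto
    have "\<exists>V c. openin (mtop M) V \<and> V \<noteq> {} \<and> V \<subseteq> W' \<and> (\<forall>i\<in>I - {p}. smooth_fun M V (c i)) \<and>
        (\<forall>x\<in>V. (\<exists>i\<in>I - {p}. c i x \<noteq> 0) \<and> (\<forall>j<m. (\<Sum>i\<in>I - {p}. c i x * ?b i j x) = 0))"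
      using Suc.prems(1) W' smooth dep by (intro Suc.IH) auto
    then obtain V c where V: "openin (mtop M) V" "V \<noteq> {}" "V \<subseteq> W'"
      and c: "\<forall>i\<in>I - {p}. smooth_fun M V (c i)"
        "\<forall>x\<in>V. (\<exists>i\<in>I - {p}. c i x \<noteq> 0) \<and> (\<forall>j<m. (\<Sum>i\<in>I - {p}. c i x * ?b i j x) = 0)"
      by blast
    let ?d = "\<lambda>i x. uneliminate I p m (\<lambda>i j. a i j x) (\<lambda>i. c i x) i"
    have "smooth_fun M V (?d i)" if i: "i \<in> I" for i
    proof (cases "i = p")
      case True
      have "smooth_fun M V (\<lambda>x. 0 - (\<Sum>l\<in>I - {p}. c l x * a l m x))"
        using V c(1) by (intro smooth_fun_diff smooth_fun_sum smooth_fun_mult smooth_fun_const M a) auto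
      then show ?thesis
        by (simp add: uneliminate_def True)
    next
      case False
      then show ?thesis
        using V c(1) i p(1)
        by (simp add: uneliminate_def) (intro smooth_fun_mult M a, auto)
    qed
    \<comment> \<open>A nonzero \<open>c i x\<close> with \<open>i\<close> different from
      \<open>p\<close> is multiplied by the pivot, which is nonzero on \<open>W'\<close>.\<close>
    moreover have "\<exists>i\<in>I. ?d i x \<noteq> 0" if "x \<in> V" for x
      using c(2) V(3) that by (fastforce simp: W'_def uneliminate_def)
    moreover have "\<forall>j<Suc m. (\<Sum>i\<in>I. ?d i x * a i j x) = 0" if "x \<in> V" for x
      using c(2) that
        uneliminate_relation[OF Suc.prems(1) p(1), of m "\<lambda>i. c i x" "\<lambda>i j. a i j x"] by blast
    ultimately show ?thesis
      using V W'(3) by (intro exI[of _ V] exI[of _ ?d]) blast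
  qed
qed


section \<open>Kernels of sections of tensor product bundles\<close>

text \<open>Grouping the indices \<open>n = i * l + j\<close> by \<open>i\<close> turns the tensor
  into a matrix. The coordinates of \<open>\<xi>\<close> become the coefficients of a combination of
  its rows.\<close>

lemma tensor_apply:
  fixes k l :: nat
  assumes T: "T = (\<Sum>n<k * l. a n *\<^sub>R tensor_prod V (e (n div l)) (f (n mod l)))"
    and \<xi>: "\<xi> \<in> dual V"
  shows "T \<xi> = (\<Sum>j<l. (\<Sum>i<k. \<xi> (e i) * a (i * l + j)) *\<^sub>R f j)"
proof -
  let ?g = "\<lambda>n. (a n * \<xi> (e (n div l))) *\<^sub>R f (n mod l)"
  have "T \<xi> = (\<Sum>n<k * l. ?g n)"
    unfolding T sum_scaleR_fun_apply using \<xi> by (simp add: tensor_prod_def)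
  also have "\<dots> = (\<Sum>i<k. \<Sum>n\<in>{i * l..<i * l + l}. ?g n)"
    by (rule sum.nat_group[symmetric])
  also have "\<dots> = (\<Sum>i<k. \<Sum>j<l. (\<xi> (e i) * a (i * l + j)) *\<^sub>R f j)"
  proof (rule sum.cong[OF refl])
    fix i
    show "(\<Sum>n\<in>{i * l..<i * l + l}. ?g n) = (\<Sum>j<l. (\<xi> (e i) * a (i * l + j)) *\<^sub>R f j)"
      by (rule sum.reindex_bij_witness[of _ "\<lambda>j. i * l + j" "\<lambda>n. n - i * l"])
        (auto simp: mult.commute le_iff_add)
  qed
  also have "\<dots> = (\<Sum>j<l. \<Sum>i<k. (\<xi> (e i) * a (i * l + j)) *\<^sub>R f j)"
    by (rule sum.swap)
  finally show ?thesis
    by (simp add: scaleR_sum_left)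
qed

lemma dual_nonzero_coordinate:
  assumes b: "is_basis n b V" and \<xi>: "\<xi> \<in> dual V" "\<xi> \<noteq> 0"
  shows "\<exists>i<n. \<xi> (b i) \<noteq> 0"
proof (rule ccontr)
  assume "\<not> ?thesis"
  then have zero: "\<xi> (b i) = 0" if "i < n" for i
    using that by blast
  obtain \<theta> where \<theta>: "\<And>i. i < n \<Longrightarrow> \<theta> i \<in> dual V"
      "\<And>i j. i < n \<Longrightarrow> j < n \<Longrightarrow> \<theta> i (b j) = (if i = j then 1 else (0::real))"
    using dual_basis[OF b] by metis
  have "\<xi> = (\<Sum>i<n. \<xi> (b i) *\<^sub>R \<theta> i)"
    using \<theta> \<xi>(1) by (intro dual_expand[OF b]) simp_all
  then have "\<xi> = 0"
    by (simp add: zero)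
  then show False
    using \<xi>(2) by simp
qed

text \<open>Together with \<open>dual_nonzero_coordinate\<close>, the dictionary between nonzero
  covectors and nontrivial coefficients of a row relation.\<close>

lemma dual_with_coordinates:
  assumes b: "is_basis n b V"
  shows "\<exists>\<xi>\<in>dual V. \<forall>i<n. \<xi> (b i) = c i"
proof -
  obtain \<theta> where \<theta>: "\<And>i. i < n \<Longrightarrow> \<theta> i \<in> dual V"
      "\<And>i j. i < n \<Longrightarrow> j < n \<Longrightarrow> \<theta> i (b j) = (if i = j then 1 else (0::real))"
    using dual_basis[OF b] by metis
  show ?thesis
    using dual_coordinates[OF b \<theta>, where c = c] by (intro bexI[of _ "\<Sum>i<n. c i *\<^sub>R \<theta> i"]) simp_all
qed

section \<open>Frames and smooth sections of vector bundles\<close>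

lemma vector_bundle_frame_at:
  assumes "vector_bundle M B" "x \<in> points M"
  obtains U e where "(U, e) \<in> frames B" "x \<in> U"
proof -
  have "points M = (\<Union>(U, e)\<in>frames B. U)"
    using assms(1) unfolding vector_bundle_def by (elim conjE)
  then show thesis
    using assms(2) that by auto
qed

lemma vector_bundle_frame:
  assumes B: "vector_bundle M B" and e: "(U, e) \<in> frames B"
  shows "openin (mtop M) U" "x \<in> U \<Longrightarrow> is_basis (vrank B) (\<lambda>i. e i x) (fibre B x)"
proof -
  have "\<forall>(U, e)\<in>frames B. openin (mtop M) U \<and>
      (\<forall>x\<in>U. is_basis (vrank B) (\<lambda>i. e i x) (fibre B x))"
    using B unfolding vector_bundle_def by (elim conjE)
  from bspec[OF this e]
  show "openin (mtop M) U" "x \<in> U \<Longrightarrow> is_basis (vrank B) (\<lambda>i. e i x) (fibre B x)"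
    by auto
qed

lemma vector_bundle_transition:
  assumes B: "vector_bundle M B" and e: "(U, e) \<in> frames B" and f: "(V, f) \<in> frames B"
  shows "\<exists>g. (\<forall>i<vrank B. \<forall>j<vrank B. smooth_fun M (U \<inter> V) (g i j)) \<and>
    (\<forall>x\<in>U \<inter> V. \<forall>j<vrank B. f j x = (\<Sum>i<vrank B. g i j x *\<^sub>R e i x))"
proof -
  have "\<forall>(U, e)\<in>frames B. \<forall>(V, f)\<in>frames B. \<exists>g.
      (\<forall>i<vrank B. \<forall>j<vrank B. smooth_fun M (U \<inter> V) (g i j)) \<and>
      (\<forall>x\<in>U \<inter> V. \<forall>j<vrank B. f j x = (\<Sum>i<vrank B. g i j x *\<^sub>R e i x))"
    using B unfolding vector_bundle_def by (elim conjE)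
  from bspec[OF bspec[OF this e, unfolded prod.case] f] show ?thesis
    by (simp only: prod.case)
qed

text \<open>Smooth values on a single frame \<open>e\<close> suffice. A frame of the dual bundle is
  dual to some frame \<open>f\<close> of \<open>B\<close>, and the coordinates of
  \<open>\<xi>\<close> in it are its values on \<open>f\<close>, which the smooth transition
  functions express through those on \<open>e\<close>.\<close>

lemma smooth_section_dual_bundle:
  assumes M: "smooth_manifold M" and B: "vector_bundle M B" and e: "(U, e) \<in> frames B"
    and V: "openin (mtop M) V" "V \<subseteq> U"
    and c: "\<And>i. i < vrank B \<Longrightarrow> smooth_fun M V (c i)"
    and \<xi>: "\<And>x. x \<in> V \<Longrightarrow> \<xi> x \<in> dual (fibre B x)"
      "\<And>x i. x \<in> V \<Longrightarrow> i < vrank B \<Longrightarrow> \<xi> x (e i x) = c i x"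
  shows "smooth_section M (dual_bundle B) V \<xi>"
proof -
  have basis: "is_basis (vrank B) (\<lambda>i. f i x) (fibre B x)" if "(W, f) \<in> frames B" "x \<in> W" for W f x
    using vector_bundle_frame(2)[OF B that] .
  have "\<exists>a. (\<forall>i<vrank B. smooth_fun M (V \<inter> W) (a i)) \<and>
      (\<forall>x\<in>V \<inter> W. \<xi> x = (\<Sum>i<vrank B. a i x *\<^sub>R \<theta> i x))"
    if "(W, \<theta>) \<in> frames (dual_bundle B)" for W \<theta>
  proof -
    have "\<exists>f. (W, f) \<in> frames B \<and> (\<forall>x\<in>W. \<forall>i<vrank B. \<theta> i x \<in> dual (fibre B x) \<and>
        (\<forall>j<vrank B. \<theta> i x (f j x) = (if i = j then 1 else 0)))"
      using that by (simp add: dual_bundle_def)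
    then obtain f where f: "(W, f) \<in> frames B"
      and \<theta>: "\<And>x i. x \<in> W \<Longrightarrow> i < vrank B \<Longrightarrow> \<theta> i x \<in> dual (fibre B x)"
        "\<And>x i j. x \<in> W \<Longrightarrow> i < vrank B \<Longrightarrow> j < vrank B \<Longrightarrow>
          \<theta> i x (f j x) = (if i = j then 1 else 0)"
      by metis
    have W: "openin (mtop M) W"
      using vector_bundle_frame(1)[OF B f] .
    obtain g where g: "\<forall>i<vrank B. \<forall>j<vrank B. smooth_fun M (U \<inter> W) (g i j)"
        "\<forall>x\<in>U \<inter> W. \<forall>j<vrank B. f j x = (\<Sum>i<vrank B. g i j x *\<^sub>R e i x)"
      using vector_bundle_transition[OF B e f] by blast
    have VW: "openin (mtop M) (V \<inter> W)" "V \<inter> W \<subseteq> U \<inter> W" "V \<inter> W \<subseteq> V"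
      using V W by auto
    have "smooth_fun M (V \<inter> W) (\<lambda>x. \<Sum>i<vrank B. g i j x * c i x)" if "j < vrank B" for j
      using that g(1) c VW
      by (intro smooth_fun_sum smooth_fun_mult M VW)
        (auto intro: smooth_fun_subset[OF _ VW(1,2)] smooth_fun_subset[OF _ VW(1,3)])
    moreover have "\<xi> x = (\<Sum>j<vrank B. (\<Sum>i<vrank B. g i j x * c i x) *\<^sub>R \<theta> j x)"
      if x: "x \<in> V \<inter> W" for x
    proof -
      have e_basis: "is_basis (vrank B) (\<lambda>i. e i x) (fibre B x)"
        using basis[OF e] x V(2) by blast
      have "\<xi> x = (\<Sum>j<vrank B. \<xi> x (f j x) *\<^sub>R \<theta> j x)"
        using \<theta> \<xi>(1) x by (intro dual_expand[OF basis[OF f]]) auto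
      also have "\<dots> = (\<Sum>j<vrank B. (\<Sum>i<vrank B. g i j x * c i x) *\<^sub>R \<theta> j x)"
      proof (rule sum.cong[OF refl])
        fix j assume j: "j \<in> {..<vrank B}"
        then have "\<xi> x (f j x) = \<xi> x (\<Sum>i<vrank B. g i j x *\<^sub>R e i x)"
          using g(2) x V(2) by (metis Int_iff lessThan_iff subsetD)
        also have "\<dots> = (\<Sum>i<vrank B. g i j x * \<xi> x (e i x))"
          using \<xi>(1) x is_basisD[OF e_basis] by (intro dual_sum) auto
        also have "\<dots> = (\<Sum>i<vrank B. g i j x * c i x)"
          using \<xi>(2) x by (intro sum.cong) auto
        finally show "\<xi> x (f j x) *\<^sub>R \<theta> j x = (\<Sum>i<vrank B. g i j x * c i x) *\<^sub>R \<theta> j x"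
          by simp
      qed
      finally show ?thesis .
    qed
    ultimately show ?thesis
      by (intro exI[of _ "\<lambda>j x. \<Sum>i<vrank B. g i j x * c i x"]) blast
  qed
  then show ?thesis
    using V(1) \<xi>(1) unfolding smooth_section_def by (auto simp: dual_bundle_def)
qed

text \<open>The matrix consists of the coordinates of \<open>A\<close> in the product of a frame of
  \<open>E\<close> and a frame of \<open>F\<close>. As the frame of \<open>F\<close> is a basis at
  each point, \<open>A x \<xi>\<close> vanishes exactly when the row combination vanishes in every
  column.\<close>

lemma tensor_section_local_matrix:
  assumes E: "vector_bundle M E" and F: "vector_bundle M F"
    and A: "smooth_section M (tensor_bundle E F) (points M) A" and x0: "x0 \<in> points M"
  obtains U e N a where "(U, e) \<in> frames E" "openin (mtop M) N" "x0 \<in> N" "N \<subseteq> U"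
    "\<And>i j. i < vrank E \<Longrightarrow> j < vrank F \<Longrightarrow> smooth_fun M N (a i j)"
    "\<And>x \<xi>. x \<in> N \<Longrightarrow> \<xi> \<in> dual (fibre E x) \<Longrightarrow>
      A x \<xi> = 0 \<longleftrightarrow> (\<forall>j<vrank F. (\<Sum>i<vrank E. \<xi> (e i x) * a i j x) = 0)"
proof -
  let ?k = "vrank E" and ?l = "vrank F"
  obtain U e where e: "(U, e) \<in> frames E" "x0 \<in> U"
    using vector_bundle_frame_at[OF E x0] .
  obtain W f where f: "(W, f) \<in> frames F" "x0 \<in> W"
    using vector_bundle_frame_at[OF F x0] .
  have UW: "openin (mtop M) U" "openin (mtop M) W"
    using vector_bundle_frame(1)[OF E e(1)] vector_bundle_frame(1)[OF F f(1)] .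
  then have N: "openin (mtop M) (U \<inter> W)" "points M \<inter> (U \<inter> W) = U \<inter> W"
    using openin_subset by blast+
  have "(U \<inter> W, \<lambda>n x. tensor_prod (fibre E x) (e (n div ?l) x) (f (n mod ?l) x))
      \<in> frames (tensor_bundle E F)"
    using e(1) f(1) by (auto simp: tensor_bundle_def)
  with A have "\<exists>a. (\<forall>n<?k * ?l. smooth_fun M (points M \<inter> (U \<inter> W)) (a n)) \<and>
      (\<forall>x\<in>points M \<inter> (U \<inter> W). A x =
        (\<Sum>n<?k * ?l. a n x *\<^sub>R tensor_prod (fibre E x) (e (n div ?l) x) (f (n mod ?l) x)))"
    unfolding smooth_section_def by (auto simp: tensor_bundle_def)
  then obtain a where a: "\<And>n. n < ?k * ?l \<Longrightarrow> smooth_fun M (U \<inter> W) (a n)"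
      "\<And>x. x \<in> U \<inter> W \<Longrightarrow> A x =
        (\<Sum>n<?k * ?l. a n x *\<^sub>R tensor_prod (fibre E x) (e (n div ?l) x) (f (n mod ?l) x))"
    unfolding N(2) by blast
  show thesis
  proof (rule that[of U e "U \<inter> W" "\<lambda>i j. a (i * ?l + j)"])
    fix i j assume "i < ?k" "j < ?l"
    \<comment> \<open>The index of the pair \<open>i\<close>, \<open>j\<close> stays below
      \<open>vrank E * vrank F\<close>, the range in which the coordinates are known to be
      smooth.\<close>
    then have "i * ?l + j < Suc i * ?l" "Suc i * ?l \<le> ?k * ?l"
      by (simp, intro mult_le_mono1, simp)
    then show "smooth_fun M (U \<inter> W) (a (i * ?l + j))"
      by (intro a(1)) linarith
  next
    fix x \<xi> assume x: "x \<in> U \<inter> W" and \<xi>: "\<xi> \<in> dual (fibre E x)"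
    have basis: "is_basis ?l (\<lambda>j. f j x) (fibre F x)"
      using x by (intro vector_bundle_frame(2)[OF F f(1)]) simp
    have "A x \<xi> = (\<Sum>j<?l. (\<Sum>i<?k. \<xi> (e i x) * a (i * ?l + j) x) *\<^sub>R f j x)"
      using tensor_apply[OF a(2)[OF x] \<xi>] .
    then show "A x \<xi> = 0 \<longleftrightarrow> (\<forall>j<?l. (\<Sum>i<?k. \<xi> (e i x) * a (i * ?l + j) x) = 0)"
      using is_basis_unique[OF basis] by auto
  qed (use e f N in auto)
qed

text \<open>The dual fibre again has dimension \<open>k\<close>, so this is the top exterior power,
  to which the kernel criterion applies.\<close>

lemma wedge_power_eq_0_iff:
  assumes E: "is_basis k e (fibre E x)" and F: "subspace (fibre F x)"
    and A: "A x \<in> tensor (fibre E x) (fibre F x)"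
  shows "wedge_power k E F A x = 0 \<longleftrightarrow> (\<exists>\<xi>\<in>dual (fibre E x). \<xi> \<noteq> 0 \<and> A x \<xi> = 0)"
proof -
  obtain \<theta> where "is_basis k \<theta> (dual (fibre E x))"
    using dual_basis[OF E] by metis
  then show ?thesis
    using A F unfolding wedge_power_def tensor_def by (intro ext_map_eq_0_iff)
qed

lemma natural_bundle_vector_bundle:
  assumes "natural_bundle B" "projective_manifold M"
  shows "vector_bundle M (nb_bundle B M)"
  by (rule assms(1)[unfolded natural_bundle_def, THEN conjunct1, THEN spec, THEN mp, OF assms(2),
      THEN conjunct1])

theorem lemma6p1:
  fixes M :: "('m, 'a::euclidean_space) pmanifold"
    and E :: "('m, 'a, 'e::real_vector) natbundle"
    and F :: "('m, 'a, 'f::real_vector) natbundle"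
    and A :: "('m, 'a) pmanifold \<Rightarrow> 'm \<Rightarrow> ('e \<Rightarrow> real) \<Rightarrow> 'f"
    and k :: nat
  assumes "projective_manifold M"
    and "natural_bundle E"
    and "natural_bundle F"
    and "natural_section (nat_tensor E F) A"
    and "k = vrank (nb_bundle E M)"
  shows "sharply_obstructs M
    (wedge_power k (nb_bundle E M) (nb_bundle F M) (A M))
    (\<lambda>V \<xi>. smooth_section M (dual_bundle (nb_bundle E M)) V \<xi> \<and>
       (\<forall>x\<in>V. \<xi> x \<noteq> 0) \<and> (\<forall>x\<in>V. A M x (\<xi> x) = 0))"
proof -
  let ?E = "nb_bundle E M" and ?F = "nb_bundle F M"
  let ?I = "wedge_power k ?E ?F (A M)"
  have M: "smooth_manifold M"
    using assms(1) by (simp add: projective_manifold_def)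
  have E: "vector_bundle M ?E" and F: "vector_bundle M ?F"
    using assms(1-3) by (blast intro: natural_bundle_vector_bundle)+
  have A: "smooth_section M (tensor_bundle ?E ?F) (points M) (A M)"
    using assms(1,4) by (simp add: natural_section_def nat_tensor_def)
  have basis: "is_basis k (\<lambda>i. e i x) (fibre ?E x)" if "(U, e) \<in> frames ?E" "x \<in> U" for U e x
    using vector_bundle_frame(2)[OF E that] unfolding assms(5) .
  have kernel: "?I x = 0 \<longleftrightarrow> (\<exists>\<xi>\<in>dual (fibre ?E x). \<xi> \<noteq> 0 \<and> A M x \<xi> = 0)"
    if x: "x \<in> points M" for x
  proof -
    obtain U e where "(U, e) \<in> frames ?E" "x \<in> U"
      using vector_bundle_frame_at[OF E x] .
    then have "is_basis k (\<lambda>i. e i x) (fibre ?E x)"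
      by (rule basis)
    moreover have "subspace (fibre ?F x)"
      using vector_bundle_frame_at[OF F x] vector_bundle_frame(2)[OF F] is_basisD(1) by metis
    moreover have "A M x \<in> tensor (fibre ?E x) (fibre ?F x)"
      using A x by (simp add: smooth_section_def tensor_bundle_def)
    ultimately show ?thesis
      by (rule wedge_power_eq_0_iff)
  qed
  \<comment> \<open>The values of a kernel covector on the frame of \<open>E\<close> are the
    coefficients of a row relation, and every row relation arises in this way.\<close>
  have dependent: "?I x = 0 \<longleftrightarrow> rows_dependent {..<k} (vrank ?F) (\<lambda>i j. a i j x)"
    if e: "(U, e) \<in> frames ?E" "x \<in> U" and x: "x \<in> points M"
      and a: "\<And>\<xi>. \<xi> \<in> dual (fibre ?E x) \<Longrightarrow>
        A M x \<xi> = 0 \<longleftrightarrow> (\<forall>j<vrank ?F. (\<Sum>i<k. \<xi> (e i x) * a i j x) = 0)"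
    for U e x a
    unfolding kernel[OF x]
  proof
    assume "\<exists>\<xi>\<in>dual (fibre ?E x). \<xi> \<noteq> 0 \<and> A M x \<xi> = 0"
    then obtain \<xi> where \<xi>: "\<xi> \<in> dual (fibre ?E x)" "\<xi> \<noteq> 0" "A M x \<xi> = 0"
      by blast
    obtain i where "i < k" "\<xi> (e i x) \<noteq> 0"
      using dual_nonzero_coordinate[OF basis[OF e] \<xi>(1,2)] by blast
    moreover have "\<forall>j<vrank ?F. (\<Sum>i<k. \<xi> (e i x) * a i j x) = 0"
      using a[OF \<xi>(1)] \<xi>(3) by simp
    ultimately show "rows_dependent {..<k} (vrank ?F) (\<lambda>i j. a i j x)"
      unfolding rows_dependent_def by (intro exI[of _ "\<lambda>i. \<xi> (e i x)"]) auto
  next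
    assume "rows_dependent {..<k} (vrank ?F) (\<lambda>i j. a i j x)"
    then obtain c where c: "\<exists>i<k. c i \<noteq> 0" "\<forall>j<vrank ?F. (\<Sum>i<k. c i * a i j x) = 0"
      unfolding rows_dependent_def by blast
    obtain \<xi> where \<xi>: "\<xi> \<in> dual (fibre ?E x)" "\<forall>i<k. \<xi> (e i x) = c i"
      using dual_with_coordinates[OF basis[OF e]] by blast
    then have "\<xi> \<noteq> 0" "A M x \<xi> = 0"
      using c a by auto
    then show "\<exists>\<xi>\<in>dual (fibre ?E x). \<xi> \<noteq> 0 \<and> A M x \<xi> = 0"
      using \<xi>(1) by blast
  qed
  have local_matrix: "\<exists>U e N a. (U, e) \<in> frames ?E \<and> openin (mtop M) N \<and> x0 \<in> N \<and> N \<subseteq> U \<and>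
      (\<forall>i<k. \<forall>j<vrank ?F. smooth_fun M N (a i j)) \<and>
      (\<forall>x\<in>N. \<forall>\<xi>\<in>dual (fibre ?E x).
        A M x \<xi> = 0 \<longleftrightarrow> (\<forall>j<vrank ?F. (\<Sum>i<k. \<xi> (e i x) * a i j x) = 0)) \<and>
      (\<forall>x\<in>N. ?I x = 0 \<longleftrightarrow> rows_dependent {..<k} (vrank ?F) (\<lambda>i j. a i j x))"
    if x0: "x0 \<in> points M" for x0
  proof (rule tensor_section_local_matrix[OF E F A x0, folded assms(5)])
    fix U e N a
    assume e: "(U, e) \<in> frames ?E" and N: "openin (mtop M) N" "x0 \<in> N" "N \<subseteq> U"
      and smooth: "\<And>i j. i < k \<Longrightarrow> j < vrank ?F \<Longrightarrow> smooth_fun M N (a i j)"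
      and a: "\<And>x \<xi>. x \<in> N \<Longrightarrow> \<xi> \<in> dual (fibre ?E x) \<Longrightarrow>
        A M x \<xi> = 0 \<longleftrightarrow> (\<forall>j<vrank ?F. (\<Sum>i<k. \<xi> (e i x) * a i j x) = 0)"
    have "?I x = 0 \<longleftrightarrow> rows_dependent {..<k} (vrank ?F) (\<lambda>i j. a i j x)" if "x \<in> N" for x
      using that N(3) openin_subset[OF N(1)] by (intro dependent[OF e _ _ a]) auto
    then show ?thesis
      using e N smooth a by (intro exI[of _ U] exI[of _ e] exI[of _ N] exI[of _ a]) simp
  qed
  show ?thesis
    unfolding sharply_obstructs_def
  proof (intro allI impI iffI, elim conjE)
    fix U W assume zero: "\<forall>x\<in>U. ?I x = 0" and W: "openin (mtop M) W" "W \<noteq> {}" "W \<subseteq> U"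
    then obtain x0 where x0: "x0 \<in> W" "x0 \<in> points M"
      using openin_subset by blast
    obtain U' e N a where e: "(U', e) \<in> frames ?E" and N: "openin (mtop M) N" "x0 \<in> N" "N \<subseteq> U'"
      and a: "\<forall>i<k. \<forall>j<vrank ?F. smooth_fun M N (a i j)"
        "\<forall>x\<in>N. \<forall>\<xi>\<in>dual (fibre ?E x).
          A M x \<xi> = 0 \<longleftrightarrow> (\<forall>j<vrank ?F. (\<Sum>i<k. \<xi> (e i x) * a i j x) = 0)"
      and dep: "\<forall>x\<in>N. ?I x = 0 \<longleftrightarrow> rows_dependent {..<k} (vrank ?F) (\<lambda>i j. a i j x)"
      using local_matrix[OF x0(2)] by (elim exE conjE)
    have WN: "openin (mtop M) (W \<inter> N)" "W \<inter> N \<noteq> {}" "W \<inter> N \<subseteq> N"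
      using W(1) N x0 by auto
    have "rows_dependent {..<k} (vrank ?F) (\<lambda>i j. a i j x)" if "x \<in> W \<inter> N" for x
      using dep zero that W(3) by blast
    moreover have "smooth_fun M (W \<inter> N) (a i j)" if "i \<in> {..<k}" "j < vrank ?F" for i j
      using a(1) that by (intro smooth_fun_subset[OF _ WN(1,3)]) simp
    ultimately obtain V c where V: "openin (mtop M) V" "V \<noteq> {}" "V \<subseteq> W \<inter> N"
      and c: "\<forall>i\<in>{..<k}. smooth_fun M V (c i)"
        "\<forall>x\<in>V. (\<exists>i\<in>{..<k}. c i x \<noteq> 0) \<and> (\<forall>j<vrank ?F. (\<Sum>i<k. c i x * a i j x) = 0)"
      using smooth_row_relation[OF M _ WN(1,2), where I = "{..<k}" and m = "vrank ?F" and a = a] by blast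
    have "\<exists>\<xi>. \<xi> \<in> dual (fibre ?E x) \<and> (\<forall>i<k. \<xi> (e i x) = c i x)" if "x \<in> V" for x
      using dual_with_coordinates[OF basis[OF e], where c = "\<lambda>i. c i x"] that V(3) N(3) by blast
    \<comment> \<open>The covectors are chosen point by point, but their values on the frame
      determine them, and these values \<open>c i\<close> are smooth.\<close>
    then obtain \<xi> where \<xi>: "\<And>x. x \<in> V \<Longrightarrow> \<xi> x \<in> dual (fibre ?E x)"
        "\<And>x i. x \<in> V \<Longrightarrow> i < k \<Longrightarrow> \<xi> x (e i x) = c i x"
      by metis
    have "smooth_section M (dual_bundle ?E) V \<xi>"
      using V(3) N(3) c(1) \<xi> unfolding assms(5)
      by (intro smooth_section_dual_bundle[OF M E e V(1), of c]) auto
    moreover have "\<xi> x \<noteq> 0" if "x \<in> V" for x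
      using c(2) \<xi>(2)[OF that] that by force
    moreover have "A M x (\<xi> x) = 0" if "x \<in> V" for x
    proof -
      have "A M x (\<xi> x) = 0 \<longleftrightarrow> (\<forall>j<vrank ?F. (\<Sum>i<k. \<xi> x (e i x) * a i j x) = 0)"
        using a(2) \<xi>(1)[OF that] that V(3) by blast
      then show ?thesis
        using c(2) \<xi>(2)[OF that] that by simp
    qed
    ultimately show "\<exists>V \<xi>. openin (mtop M) V \<and> V \<noteq> {} \<and> V \<subseteq> W \<and>
        (smooth_section M (dual_bundle ?E) V \<xi> \<and> (\<forall>x\<in>V. \<xi> x \<noteq> 0) \<and> (\<forall>x\<in>V. A M x (\<xi> x) = 0))"
      using V by blast
  next
    fix U assume U: "openin (mtop M) U"
      and local: "\<forall>W. openin (mtop M) W \<and> W \<noteq> {} \<and> W \<subseteq> U \<longrightarrow>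
        (\<exists>V \<xi>. openin (mtop M) V \<and> V \<noteq> {} \<and> V \<subseteq> W \<and>
          (smooth_section M (dual_bundle ?E) V \<xi> \<and> (\<forall>x\<in>V. \<xi> x \<noteq> 0) \<and> (\<forall>x\<in>V. A M x (\<xi> x) = 0)))"
    show "\<forall>x\<in>U. ?I x = 0"
    proof (rule ccontr)
      assume "\<not> ?thesis"
      then obtain x0 where x0: "x0 \<in> U" "?I x0 \<noteq> 0" "x0 \<in> points M"
        using openin_subset[OF U] by blast
      obtain U' e N a where e: "(U', e) \<in> frames ?E" and N: "openin (mtop M) N" "x0 \<in> N" "N \<subseteq> U'"
        and a: "\<forall>i<k. \<forall>j<vrank ?F. smooth_fun M N (a i j)"
          "\<forall>x\<in>N. \<forall>\<xi>\<in>dual (fibre ?E x).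
            A M x \<xi> = 0 \<longleftrightarrow> (\<forall>j<vrank ?F. (\<Sum>i<k. \<xi> (e i x) * a i j x) = 0)"
        and dep: "\<forall>x\<in>N. ?I x = 0 \<longleftrightarrow> rows_dependent {..<k} (vrank ?F) (\<lambda>i j. a i j x)"
        using local_matrix[OF x0(3)] by (elim exE conjE)
      have NM: "topspace (subtopology (mtop M) N) = N"
        by (rule topspace_subtopology_subset[OF openin_subset[OF N(1)]])
      \<comment> \<open>The matrix is controlled only on \<open>N\<close>, so openness of
        independence is applied in the subspace \<open>N\<close>; as \<open>N\<close> is open, the
        result is open in the manifold.\<close>
      have "\<exists>W. openin (subtopology (mtop M) N) W \<and> x0 \<in> W \<and>
          (\<forall>y\<in>W. \<not> rows_dependent {..<k} (vrank ?F) (\<lambda>i j. a i j y))"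
        using x0(2,3) N(2) dep a(1)
        by (intro rows_independent_openin) (auto simp: NM intro: smooth_fun_continuous[OF M])
      then obtain W where W: "openin (subtopology (mtop M) N) W" "x0 \<in> W"
          "\<forall>y\<in>W. \<not> rows_dependent {..<k} (vrank ?F) (\<lambda>i j. a i j y)"
        by blast
      have "W \<subseteq> N" "openin (mtop M) W"
        using openin_subset[OF W(1)] NM openin_trans_full[OF W(1) N(1)] by auto
      then have "openin (mtop M) (W \<inter> U)" "W \<inter> U \<noteq> {}" "W \<inter> U \<subseteq> U"
        using U W(2) x0(1) by auto
      \<comment> \<open>The solution need not be defined at \<open>x0\<close>. Since it lives in
        \<open>W\<close>, where the rows remain independent, any point of the nonempty set
        \<open>V\<close> gives the contradiction.\<close>
      with local obtain V \<xi> where V: "V \<noteq> {}" "V \<subseteq> W \<inter> U"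
        and \<xi>: "smooth_section M (dual_bundle ?E) V \<xi>" "\<forall>x\<in>V. \<xi> x \<noteq> 0" "\<forall>x\<in>V. A M x (\<xi> x) = 0"
        by meson
      then obtain x where x: "x \<in> V" by blast
      have "\<xi> x \<in> dual (fibre ?E x)"
        using \<xi>(1) x by (simp add: smooth_section_def dual_bundle_def)
      then have "?I x = 0"
        using \<xi>(2,3) x V(2) openin_subset[OF U] kernel[of x] by blast
      then show False
        using dep W(3) \<open>W \<subseteq> N\<close> x V(2) by blast
    qed
  qed
qed

end
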